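(* Let $f:\mathbb{R}^n\to\mathbb{R}$ be an $s$-sparse differentiable function and let $\xi$ be the cost of computing a directional derivative. For an initial alignment $\gamma_0\in(0,1)$, the refresh of the alignment vector by the IHT algorithm with a Gaussian matrix of appropriate variance (described in the context) requires a computational cost of $$O\left(\log\left(\frac{1-Ce^{-ck'}}{1-Ce^{-ck'}-\gamma_0}\right)k'n+k'\xi\right),$$ where $k'\gtrsim s\log(n/s)$ and $C,c>0$ are constants independent of $n,s$.
   Context: $f$ is $s$-sparse (axis-aligned) if it depends only on $s$ fixed coordinates of its input; hence $\nabla f(x)$ is an $s$-sparse vector. A refresh at a point $x$ with initial alignment $\gamma_0$ means producing a random vector $v$ with $\mathbb{E}[\langle\hat v,\nabla f(x)\rangle^2]\ge\gamma_0\|\nabla f(x)\|^2$, where $\hat v=v/\|v\|$. Iterative hard thresholding (IHT): draw $\Psi\in\mathbb{R}^{k'\times n}$ with i.i.d. entries $N(0,1/k')$, compute $z=\Psi\nabla f(x)$ (by $k'$ directional derivatives), set $y_0=0$ and iterate $y_{t+1}=H_s[y_t+\mu\Psi^\top(z-\Psi y_t)]$, where $H_s$ sets all but the $s$ largest-magnitude entries to $0$, $\mu=\frac1{1+\delta_s}$, and $\delta_s$ is the restricted isometry constant of order $s$: $(1-\delta_s)\|w\|^2\le\|\Psi w\|^2\le(1+\delta_s)\|w\|^2$ for all $s$-sparse $w$. The output is $v=y_T$. The number of iterations is $T=\lceil\log(1/\rho)/\log2\rceil$, where $\rho$ is the relative recovery error ($\|y_T-\nabla f(x)\|\le\rho\|\nabla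 f(x)\|$) and $\gamma_0=(1-\rho^2)p$ with $p=1-Ce^{-ck'}$ a lower bound on the probability that this recovery guarantee holds. Known facts fixing the constants: recovery holds with $\|y_t-\nabla f(x)\|\le2^{-t}\|\nabla f(x)\|$ when $\delta_{3s}<1/15$, and for $k'\gtrsim s\log(n/s)$ the Gaussian $\Psi$ has $\delta_{3s}\le1/15$ with probability at least $1-Ce^{-ck'}$. Each matrix-vector multiplication with $\Psi$ or $\Psi^\top$ costs $O(k'n)$.
   Formalization: For n < 2s, k' ≳ s is also required (with s = n and k' much smaller than n the refresh fails); the O-constant is uniform only for γ₀ bounded away from 0 (at least one iteration is run, while the logarithm tends to 0); γ₀ < 1 − Ce^{−ck'} is assumed so that the logarithm is defined. *)

theory Defs
  imports "HOL-Probability.Probability"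
begin

text \<open>
  The constants of the result do not depend on the dimension, so the dimension has to be quantified
  inside the statement and cannot be a type. A vector of the Euclidean space of dimension \<open>n\<close> is a
  function on \<^typ>\<open>nat\<close> of which only the entries with index below \<open>n\<close> matter; a matrix is a
  function on index pairs (row, column).
\<close>

type_synonym rvec = "nat \<Rightarrow> real"
type_synonym rmat = "nat \<times> nat \<Rightarrow> real"

definition norm_Rn :: "nat \<Rightarrow> rvec \<Rightarrow> real" where
  "norm_Rn n v = L2_set v {..<n}"

definition inner_Rn :: "nat \<Rightarrow> rvec \<Rightarrow> rvec \<Rightarrow> real" where
  "inner_Rn n v w = (\<Sum>i<n. v i * w i)"

text \<open>The normalisation of the zero vector is the zero vector, since \<open>x / 0 = 0\<close>.\<close>

definition normalize_Rn :: "nat \<Rightarrow> rvec \<Rightarrow> rvec" where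
  "normalize_Rn n v = (\<lambda>i. v i / norm_Rn n v)"

definition sparse_vec :: "nat \<Rightarrow> nat \<Rightarrow> rvec \<Rightarrow> bool" where
  "sparse_vec n s w \<longleftrightarrow> card {i. i < n \<and> w i \<noteq> 0} \<le> s"

text \<open>Since the relevant coordinates lie below \<open>n\<close>, this also says that \<open>f\<close> is a function on
  the Euclidean space of dimension \<open>n\<close>.\<close>

definition sparse_fun :: "nat \<Rightarrow> nat \<Rightarrow> (rvec \<Rightarrow> real) \<Rightarrow> bool" where
  "sparse_fun n s f \<longleftrightarrow>
     (\<exists>S \<subseteq> {..<n}. card S = s \<and> (\<forall>x y. (\<forall>i\<in>S. x i = y i) \<longrightarrow> f x = f y))"

text \<open>Frechet differentiability; the library notion needs a normed type.\<close>

definition has_gradient :: "nat \<Rightarrow> (rvec \<Rightarrow> real) \<Rightarrow> rvec \<Rightarrow> rvec \<Rightarrow> bool" where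
  "has_gradient n f g x \<longleftrightarrow>
     (\<forall>e>0. \<exists>d>0. \<forall>h. norm_Rn n h < d \<longrightarrow>
        \<bar>f (\<lambda>i. x i + h i) - f x - inner_Rn n g h\<bar> \<le> e * norm_Rn n h)"

definition differentiable_Rn :: "nat \<Rightarrow> (rvec \<Rightarrow> real) \<Rightarrow> bool" where
  "differentiable_Rn n f \<longleftrightarrow> (\<forall>x. \<exists>g. has_gradient n f g x)"

definition grad :: "(rvec \<Rightarrow> real) \<Rightarrow> rvec \<Rightarrow> rvec" where
  "grad f x = (\<lambda>i. deriv (\<lambda>t. f (x(i := t))) (x i))"

definition dir_deriv :: "(rvec \<Rightarrow> real) \<Rightarrow> rvec \<Rightarrow> rvec \<Rightarrow> real" where
  "dir_deriv f x u = deriv (\<lambda>t. f (\<lambda>i. x i + t * u i)) 0"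

definition mat_vec :: "nat \<Rightarrow> rmat \<Rightarrow> rvec \<Rightarrow> rvec" where
  "mat_vec n \<Psi> w = (\<lambda>i. \<Sum>j<n. \<Psi> (i, j) * w j)"

definition tmat_vec :: "nat \<Rightarrow> rmat \<Rightarrow> rvec \<Rightarrow> rvec" where
  "tmat_vec k \<Psi> u = (\<lambda>j. \<Sum>i<k. \<Psi> (i, j) * u i)"

text \<open>The second parameter of \<^const>\<open>normal_density\<close> is the standard deviation, so the entries
  have variance \<open>1 / k\<close>.\<close>

definition gaussian_matrix :: "nat \<Rightarrow> nat \<Rightarrow> rmat measure" where
  "gaussian_matrix k n =
     Pi\<^sub>M ({..<k} \<times> {..<n}) (\<lambda>_. density lborel (normal_density 0 (1 / sqrt (real k))))"

definition restricted_isometry_constant :: "nat \<Rightarrow> nat \<Rightarrow> nat \<Rightarrow> rmat \<Rightarrow> real" where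
  "restricted_isometry_constant k n s \<Psi> =
     Inf {\<delta>. 0 \<le> \<delta> \<and> (\<forall>w. sparse_vec n s w \<longrightarrow>
       (1 - \<delta>) * (norm_Rn n w)\<^sup>2 \<le> (norm_Rn k (mat_vec n \<Psi> w))\<^sup>2 \<and>
       (norm_Rn k (mat_vec n \<Psi> w))\<^sup>2 \<le> (1 + \<delta>) * (norm_Rn n w)\<^sup>2)}"

text \<open>
  The regime of at least order \<open>s * ln (n / s)\<close> measurements. The logarithm degenerates as \<open>s\<close>
  approaches \<open>n\<close> (for \<open>s = n\<close> it would allow a single measurement), so beyond \<open>n / 2\<close> order \<open>s\<close>
  is required as well; below \<open>n / 2\<close> this is implied.
\<close>

definition enough_measurements :: "real \<Rightarrow> nat \<Rightarrow> nat \<Rightarrow> nat \<Rightarrow> bool" where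
  "enough_measurements K n s k \<longleftrightarrow>
     K * real s * ln (real n / real s) \<le> real k \<and> (n < 2 * s \<longrightarrow> K * real s \<le> real k)"

text \<open>\<open>C\<close>, \<open>c\<close> and \<open>K\<close> are valid constants in the restricted isometry theorem for Gaussian
  matrices.\<close>

definition gaussian_rip_constants :: "real \<Rightarrow> real \<Rightarrow> real \<Rightarrow> bool" where
  "gaussian_rip_constants C c K \<longleftrightarrow> 0 < C \<and> 0 < c \<and> 0 < K \<and>
     (\<forall>n s k. 1 \<le> s \<and> s \<le> n \<and> enough_measurements K n s k \<longrightarrow>
        measure (gaussian_matrix k n)
          {\<Psi> \<in> space (gaussian_matrix k n). restricted_isometry_constant k n (3 * s) \<Psi> \<le> 1 / 15}
        \<ge> 1 - C * exp (- c * real k))"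

text \<open>Entry \<open>i\<close> is kept iff fewer than \<open>s\<close> entries precede it when the entries are sorted by
  decreasing magnitude, ties being broken in favour of the smaller index.\<close>

definition hard_threshold :: "nat \<Rightarrow> nat \<Rightarrow> rvec \<Rightarrow> rvec" where
  "hard_threshold n s v = (\<lambda>i.
     if i < n \<and> card {j. j < n \<and> (\<bar>v i\<bar> < \<bar>v j\<bar> \<or> \<bar>v j\<bar> = \<bar>v i\<bar> \<and> j < i)} < s then v i else 0)"

text \<open>Computations that return a value together with the cost of computing it.\<close>

type_synonym 'a costed = "'a \<times> real"

definition ret :: "'a \<Rightarrow> 'a costed" where
  "ret a = (a, 0)"

definition charge :: "real \<Rightarrow> 'a \<Rightarrow> 'a costed" where
  "charge c a = (a, c)"

definition bind_costed :: "'a costed \<Rightarrow> ('a \<Rightarrow> 'b costed) \<Rightarrow> 'b costed" where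
  "bind_costed m h = (fst (h (fst m)), snd m + snd (h (fst m)))"

adhoc_overloading Monad_Syntax.bind \<rightleftharpoons> bind_costed

text \<open>
  Prices of the primitive operations other than directional derivatives: \<open>matvec_cost k n\<close> for a
  product with a \<open>k\<close> by \<open>n\<close> matrix or its transpose, \<open>vecop_cost m\<close> for a sum, difference or
  scaling of vectors of length \<open>m\<close>, \<open>threshold_cost n s\<close> for selecting the \<open>s\<close> largest of \<open>n\<close>
  entries, \<open>sample_cost\<close> for drawing one Gaussian number. The bound \<open>s * n\<close> is what \<open>s\<close> scans for
  a maximum need.
\<close>

record cost_model =
  matvec_cost :: "nat \<Rightarrow> nat \<Rightarrow> real"
  vecop_cost :: "nat \<Rightarrow> real"
  threshold_cost :: "nat \<Rightarrow> nat \<Rightarrow> real"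
  sample_cost :: real

definition costs_bounded :: "real \<Rightarrow> cost_model \<Rightarrow> bool" where
  "costs_bounded B M \<longleftrightarrow>
     (\<forall>k>0. \<forall>n>0. matvec_cost M k n \<le> B * real k * real n) \<and>
     (\<forall>m>0. vecop_cost M m \<le> B * real m) \<and>
     (\<forall>n>0. \<forall>s>0. threshold_cost M n s \<le> B * real s * real n) \<and>
     sample_cost M \<le> B"

text \<open>The first \<open>k\<close> measurements; \<open>\<xi>\<close> is the price of one directional derivative.\<close>

primrec measurements :: "real \<Rightarrow> (rvec \<Rightarrow> real) \<Rightarrow> rvec \<Rightarrow> rmat \<Rightarrow> nat \<Rightarrow> rvec costed" where
  "measurements \<xi> f x \<Psi> 0 = ret (\<lambda>_. 0)"
| "measurements \<xi> f x \<Psi> (Suc i) = do {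
     z \<leftarrow> measurements \<xi> f x \<Psi> i;
     d \<leftarrow> charge \<xi> (dir_deriv f x (\<lambda>j. \<Psi> (i, j)));
     ret (z(i := d))
   }"

definition iht_step ::
  "cost_model \<Rightarrow> nat \<Rightarrow> nat \<Rightarrow> nat \<Rightarrow> rmat \<Rightarrow> real \<Rightarrow> rvec \<Rightarrow> rvec \<Rightarrow> rvec costed" where
  "iht_step M k n s \<Psi> \<mu> z y = do {
     u \<leftarrow> charge (matvec_cost M k n) (mat_vec n \<Psi> y);
     r \<leftarrow> charge (vecop_cost M k) (\<lambda>i. z i - u i);
     b \<leftarrow> charge (matvec_cost M k n) (tmat_vec k \<Psi> r);
     d \<leftarrow> charge (vecop_cost M n) (\<lambda>i. \<mu> * b i);
     a \<leftarrow> charge (vecop_cost M n) (\<lambda>i. y i + d i);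
     charge (threshold_cost M n s) (hard_threshold n s a)
   }"

primrec iht_iterate ::
  "cost_model \<Rightarrow> nat \<Rightarrow> nat \<Rightarrow> nat \<Rightarrow> rmat \<Rightarrow> real \<Rightarrow> rvec \<Rightarrow> nat \<Rightarrow> rvec costed" where
  "iht_iterate M k n s \<Psi> \<mu> z 0 = ret (\<lambda>_. 0)"
| "iht_iterate M k n s \<Psi> \<mu> z (Suc t) = do {
     y \<leftarrow> iht_iterate M k n s \<Psi> \<mu> z t;
     iht_step M k n s \<Psi> \<mu> z y
   }"

text \<open>The run of the algorithm for the drawn matrix \<open>\<Psi>\<close>, with \<open>T\<close> iterations. The step size is
  treated as given and is not charged.\<close>

definition iht ::
  "cost_model \<Rightarrow> real \<Rightarrow> nat \<Rightarrow> nat \<Rightarrow> nat \<Rightarrow> nat \<Rightarrow> (rvec \<Rightarrow> real) \<Rightarrow> rvec \<Rightarrow> rmat \<Rightarrow> rvec costed" where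
  "iht M \<xi> k n s T f x \<Psi> = do {
     \<Psi>' \<leftarrow> charge (real k * real n * sample_cost M) \<Psi>;
     z \<leftarrow> measurements \<xi> f x \<Psi>' k;
     iht_iterate M k n s \<Psi>' (1 / (1 + restricted_isometry_constant k n s \<Psi>')) z T
   }"

text \<open>The solution \<open>\<rho> \<ge> 0\<close> of \<open>\<gamma> = (1 - \<rho>\<^sup>2) * p\<close>.\<close>

definition recovery_error :: "real \<Rightarrow> real \<Rightarrow> real" where
  "recovery_error p \<gamma> = sqrt (1 - \<gamma> / p)"

definition iht_iterations :: "real \<Rightarrow> nat" where
  "iht_iterations \<rho> = nat \<lceil>ln (1 / \<rho>) / ln 2\<rceil>"

definition is_refresh :: "'w measure \<Rightarrow> nat \<Rightarrow> (rvec \<Rightarrow> real) \<Rightarrow> rvec \<Rightarrow> ('w \<Rightarrow> rvec) \<Rightarrow> real \<Rightarrow> bool" where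
  "is_refresh P n f x v \<gamma> \<longleftrightarrow>
     (\<forall>i<n. (\<lambda>\<omega>. v \<omega> i) \<in> borel_measurable P) \<and>
     (\<integral>\<omega>. (inner_Rn n (normalize_Rn n (v \<omega>)) (grad f x))\<^sup>2 \<partial>P) \<ge> \<gamma> * (norm_Rn n (grad f x))\<^sup>2"

end

theory Submission
  imports Defs
begin

text \<open>
  Restricted to \<open>3 s\<close> coordinates, the quadratic form \<open>\<parallel>w\<parallel>\<^sup>2 - \<mu> \<parallel>\<Psi> w\<parallel>\<^sup>2\<close> is at most \<open>\<parallel>w\<parallel>\<^sup>2 / 8\<close> in absolute
  value when the restricted isometry constant is at most \<open>1 / 15\<close>. By polarisation the gradient step
  shrinks the error on these coordinates by the factor \<open>8\<close>, and hard thresholding at most doubles it, so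
  every iteration at least halves the distance to the gradient. After \<open>T\<close> iterations the relative error
  is at most \<open>\<rho>\<close>, so the squared alignment is at least \<open>1 - \<rho>\<^sup>2 = \<gamma>\<^sub>0 / p\<close> on an event of probability at
  least \<open>p\<close>. As \<open>ln (1 / \<rho>)\<close> is half of \<open>ln (p / (p - \<gamma>\<^sub>0))\<close>, this logarithm controls \<open>T\<close>; it is bounded
  away from \<open>0\<close> because \<open>\<gamma>\<^sub>0 \<ge> \<eta>\<close> and \<open>p \<le> 1\<close>, and therefore also absorbs the rounding of \<open>T\<close> and the
  sampling of the matrix.

  For Gaussian matrices, \<open>\<parallel>\<Psi> w\<parallel>\<^sup>2\<close> is a scaled sum of squares of independent normal variables, and
  Chernoff's bound shows that it concentrates around \<open>\<parallel>w\<parallel>\<^sup>2\<close>. A union bound over a net of sparse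
  vectors with integer entries gives the restricted isometry property.
\<close>

section \<open>Restricted isometries\<close>

lemma norm_Rn_sq: "(norm_Rn n v)\<^sup>2 = (\<Sum>i<n. (v i)\<^sup>2)"
  by (simp add: norm_Rn_def L2_set_def sum_nonneg)

lemma norm_Rn_nonneg [simp]: "0 \<le> norm_Rn n v"
  by (simp add: norm_Rn_def L2_set_nonneg)

lemma norm_Rn_eq_0_iff: "norm_Rn n v = 0 \<longleftrightarrow> (\<forall>i<n. v i = 0)"
  by (auto simp: norm_Rn_def L2_set_eq_0_iff)

lemma inner_Rn_self: "inner_Rn n v v = (norm_Rn n v)\<^sup>2"
  unfolding norm_Rn_sq by (simp add: inner_Rn_def power2_eq_square)

lemma norm_Rn_triangle: "norm_Rn n (\<lambda>i. v i + w i) \<le> norm_Rn n v + norm_Rn n w"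
  unfolding norm_Rn_def by (rule L2_set_triangle_ineq)

lemma norm_Rn_scale: "norm_Rn n (\<lambda>i. c * v i) = \<bar>c\<bar> * norm_Rn n v"
  by (simp add: norm_Rn_def L2_set_def power_mult_distrib real_sqrt_mult flip: sum_distrib_left)

lemma abs_inner_Rn_le: "\<bar>inner_Rn n v w\<bar> \<le> norm_Rn n v * norm_Rn n w"
proof -
  have "\<bar>inner_Rn n v w\<bar> \<le> (\<Sum>i<n. \<bar>v i\<bar> * \<bar>w i\<bar>)"
    unfolding inner_Rn_def by (rule order_trans[OF sum_abs]) (simp add: abs_mult)
  then show ?thesis
    using L2_set_mult_ineq[of v w "{..<n}"] by (simp add: norm_Rn_def)
qed

lemma inner_tmat_vec: "inner_Rn n (tmat_vec k \<Psi> u) w = inner_Rn k u (mat_vec n \<Psi> w)"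
  unfolding inner_Rn_def tmat_vec_def mat_vec_def
  by (subst sum_distrib_left, subst sum_distrib_right, subst sum.swap) (simp add: mult_ac)

lemma mat_vec_linear:
  "mat_vec n \<Psi> (\<lambda>i. a * u i + b * v i) = (\<lambda>i. a * mat_vec n \<Psi> u i + b * mat_vec n \<Psi> v i)"
  by (simp add: mat_vec_def sum.distrib algebra_simps sum_distrib_left)

lemma mat_vec_scale: "mat_vec n \<Psi> (\<lambda>i. a * u i) = (\<lambda>i. a * mat_vec n \<Psi> u i)"
  by (simp add: mat_vec_def algebra_simps sum_distrib_left)

lemma mat_vec_diff: "mat_vec n \<Psi> (\<lambda>i. u i - v i) = (\<lambda>i. mat_vec n \<Psi> u i - mat_vec n \<Psi> v i)"
  by (simp add: mat_vec_def algebra_simps sum_subtractf)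

text \<open>Cauchy-Schwarz in every row. The squared Frobenius norm is a crude bound, but a finite
  one, which is what the existence of an isometry constant requires.\<close>

lemma norm_mat_vec_le:
  "(norm_Rn k (mat_vec n \<Psi> w))\<^sup>2 \<le> (\<Sum>i<k. \<Sum>j<n. (\<Psi> (i, j))\<^sup>2) * (norm_Rn n w)\<^sup>2"
proof -
  have "(mat_vec n \<Psi> w i)\<^sup>2 \<le> (\<Sum>j<n. (\<Psi> (i, j))\<^sup>2) * (norm_Rn n w)\<^sup>2" for i
    using power_mono[OF abs_inner_Rn_le[of n "\<lambda>j. \<Psi> (i, j)" w], of 2]
    by (simp add: inner_Rn_def mat_vec_def power_mult_distrib norm_Rn_sq)
  then show ?thesis
    unfolding norm_Rn_sq[of k] sum_distrib_right by (intro sum_mono)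
qed

text \<open>The bilinear form of \<open>I - \<mu> \<Psi>^T \<Psi>\<close>. For
  \<open>\<mu> = 1\<close> its size on sparse vectors is the restricted isometry constant; for the
  step size of the algorithm it governs how a gradient step changes the error.\<close>

definition defect :: "nat \<Rightarrow> nat \<Rightarrow> real \<Rightarrow> rmat \<Rightarrow> rvec \<Rightarrow> rvec \<Rightarrow> real" where
  "defect n k \<mu> \<Psi> u v = inner_Rn n u v - \<mu> * inner_Rn k (mat_vec n \<Psi> u) (mat_vec n \<Psi> v)"

lemma defect_self: "defect n k \<mu> \<Psi> u u = (norm_Rn n u)\<^sup>2 - \<mu> * (norm_Rn k (mat_vec n \<Psi> u))\<^sup>2"
  by (simp add: defect_def inner_Rn_self)

lemma inner_Rn_polar:
  "4 * (a * b * inner_Rn n u v) =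
    inner_Rn n (\<lambda>i. a * u i + b * v i) (\<lambda>i. a * u i + b * v i) -
    inner_Rn n (\<lambda>i. a * u i + (- b) * v i) (\<lambda>i. a * u i + (- b) * v i)"
  by (simp add: inner_Rn_def sum_distrib_left algebra_simps flip: sum_subtractf sum.distrib)

text \<open>The difference is written with the coefficient \<open>- b\<close> so that
  \<open>mat_vec_linear\<close> applies to both combinations.\<close>

lemma defect_polar:
  "4 * (a * b * defect n k \<mu> \<Psi> u v) =
    defect n k \<mu> \<Psi> (\<lambda>i. a * u i + b * v i) (\<lambda>i. a * u i + b * v i) -
    defect n k \<mu> \<Psi> (\<lambda>i. a * u i + (- b) * v i) (\<lambda>i. a * u i + (- b) * v i)"
proof -
  have "4 * (a * b * defect n k \<mu> \<Psi> u v) =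
      4 * (a * b * inner_Rn n u v) - \<mu> * (4 * (a * b * inner_Rn k (mat_vec n \<Psi> u) (mat_vec n \<Psi> v)))"
    by (simp add: defect_def algebra_simps)
  then show ?thesis
    unfolding inner_Rn_polar defect_def mat_vec_linear by (simp add: algebra_simps)
qed

lemma norm_Rn_parallelogram:
  "(norm_Rn n (\<lambda>i. a * u i + b * v i))\<^sup>2 + (norm_Rn n (\<lambda>i. a * u i + (- b) * v i))\<^sup>2 =
    2 * a\<^sup>2 * (norm_Rn n u)\<^sup>2 + 2 * b\<^sup>2 * (norm_Rn n v)\<^sup>2"
  unfolding norm_Rn_sq
  by (simp add: sum_distrib_left power2_eq_square algebra_simps flip: sum.distrib)

text \<open>Polarisation, applied to \<open>u\<close> and \<open>v\<close> scaled to equal norms.\<close>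

lemma abs_defect_le:
  assumes q: "\<And>w. (\<And>i. i < n \<Longrightarrow> i \<notin> U \<Longrightarrow> w i = 0) \<Longrightarrow> \<bar>defect n k \<mu> \<Psi> w w\<bar> \<le> \<epsilon> * (norm_Rn n w)\<^sup>2"
    and u: "\<And>i. i < n \<Longrightarrow> i \<notin> U \<Longrightarrow> u i = 0" and v: "\<And>i. i < n \<Longrightarrow> i \<notin> U \<Longrightarrow> v i = 0"
  shows "\<bar>defect n k \<mu> \<Psi> u v\<bar> \<le> \<epsilon> * norm_Rn n u * norm_Rn n v"
proof (cases "norm_Rn n u = 0 \<or> norm_Rn n v = 0")
  case True
  then have "defect n k \<mu> \<Psi> u v = 0"
    by (auto simp: norm_Rn_eq_0_iff defect_def inner_Rn_def mat_vec_def)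
  with True show ?thesis by auto
next
  case False
  define a where "a = norm_Rn n v"
  define b where "b = norm_Rn n u"
  have pos: "a > 0" "b > 0"
    using False norm_Rn_nonneg[of n u] norm_Rn_nonneg[of n v] unfolding a_def b_def by linarith+
  let ?p = "\<lambda>i. a * u i + b * v i" and ?m = "\<lambda>i. a * u i + (- b) * v i"
  have "\<bar>4 * (a * b * defect n k \<mu> \<Psi> u v)\<bar> \<le> \<bar>defect n k \<mu> \<Psi> ?p ?p\<bar> + \<bar>defect n k \<mu> \<Psi> ?m ?m\<bar>"
    unfolding defect_polar by (rule abs_triangle_ineq4)
  also have "\<dots> \<le> \<epsilon> * (norm_Rn n ?p)\<^sup>2 + \<epsilon> * (norm_Rn n ?m)\<^sup>2"
    by (intro add_mono q) (simp_all add: u v)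
  also have "\<dots> = \<epsilon> * (2 * a\<^sup>2 * b\<^sup>2 + 2 * b\<^sup>2 * a\<^sup>2)"
    unfolding distrib_left[symmetric] norm_Rn_parallelogram by (simp add: a_def b_def)
  finally have "(a * b) * \<bar>defect n k \<mu> \<Psi> u v\<bar> \<le> (a * b) * (\<epsilon> * b * a)"
    using pos by (simp add: abs_mult power2_eq_square algebra_simps)
  then show ?thesis
    using pos by (simp add: a_def b_def)
qed

section \<open>The restricted isometry constant as an attained infimum\<close>

definition restricted_isometry :: "nat \<Rightarrow> nat \<Rightarrow> nat \<Rightarrow> rmat \<Rightarrow> real \<Rightarrow> bool" where
  "restricted_isometry k n s \<Psi> \<delta> \<longleftrightarrow> (\<forall>w. sparse_vec n s w \<longrightarrow>
       (1 - \<delta>) * (norm_Rn n w)\<^sup>2 \<le> (norm_Rn k (mat_vec n \<Psi> w))\<^sup>2 \<and>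
       (norm_Rn k (mat_vec n \<Psi> w))\<^sup>2 \<le> (1 + \<delta>) * (norm_Rn n w)\<^sup>2)"

lemma restricted_isometry_iff_defect:
  "restricted_isometry k n s \<Psi> \<delta> \<longleftrightarrow>
    (\<forall>w. sparse_vec n s w \<longrightarrow> \<bar>defect n k 1 \<Psi> w w\<bar> \<le> \<delta> * (norm_Rn n w)\<^sup>2)"
  unfolding restricted_isometry_def defect_self abs_le_iff by (auto simp: algebra_simps)

lemma restricted_isometry_mono:
  assumes "restricted_isometry k n s \<Psi> \<delta>" "\<delta> \<le> \<delta>'"
  shows "restricted_isometry k n s \<Psi> \<delta>'"
  using assms order_trans[OF _ mult_right_mono[OF assms(2) zero_le_power2]]
  unfolding restricted_isometry_iff_defect by blast

lemma restricted_isometry_subset: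
  assumes "restricted_isometry k n s \<Psi> \<delta>" "s' \<le> s"
  shows "restricted_isometry k n s' \<Psi> \<delta>"
  using assms unfolding restricted_isometry_def sparse_vec_def by (meson order_trans)

lemma restricted_isometry_exists: "\<exists>\<delta>\<ge>0. restricted_isometry k n s \<Psi> \<delta>"
proof -
  define F where "F = (\<Sum>i<k. \<Sum>j<n. (\<Psi> (i, j))\<^sup>2)"
  have F: "0 \<le> F" unfolding F_def by (intro sum_nonneg) simp
  \<comment> \<open>For the constant \<open>F + 1\<close> the factor in the lower bound is
    \<open>- F\<close>, which makes that bound trivial.\<close>
  have "(1 - (F + 1)) * (norm_Rn n w)\<^sup>2 \<le> 0" for w
    using F by (simp add: mult_nonneg_nonneg)
  moreover have "F * (norm_Rn n w)\<^sup>2 \<le> (1 + (F + 1)) * (norm_Rn n w)\<^sup>2" for w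
    by (intro mult_right_mono) auto
  ultimately have "restricted_isometry k n s \<Psi> (F + 1)"
    unfolding restricted_isometry_def
    using norm_mat_vec_le[of k n \<Psi>, folded F_def] by (meson order_trans zero_le_power2)
  with F show ?thesis by (intro exI[of _ "F + 1"]) auto
qed

lemma restricted_isometry_constant_altdef:
  "restricted_isometry_constant k n s \<Psi> = Inf {\<delta>. 0 \<le> \<delta> \<and> restricted_isometry k n s \<Psi> \<delta>}"
  by (simp add: restricted_isometry_constant_def restricted_isometry_def)

lemma restricted_isometry_constant_nonneg: "0 \<le> restricted_isometry_constant k n s \<Psi>"
  unfolding restricted_isometry_constant_altdef
  using restricted_isometry_exists by (intro cInf_greatest) auto

text \<open>The infimum is attained: for a fixed \<open>w\<close> of nonzero norm the condition says
  that a fixed quotient is a lower bound of the admissible constants, and lower bounds pass to the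
  infimum.\<close>

lemma restricted_isometry_constant_holds:
  "restricted_isometry k n s \<Psi> (restricted_isometry_constant k n s \<Psi>)"
proof -
  define D where "D = {\<delta>. 0 \<le> \<delta> \<and> restricted_isometry k n s \<Psi> \<delta>}"
  have ne: "D \<noteq> {}" using restricted_isometry_exists by (auto simp: D_def)
  have "\<bar>defect n k 1 \<Psi> w w\<bar> \<le> Inf D * (norm_Rn n w)\<^sup>2" if w: "sparse_vec n s w" for w
  proof (cases "norm_Rn n w = 0")
    case True
    then show ?thesis
      using ne w unfolding D_def restricted_isometry_iff_defect by fastforce
  next
    case False
    then have pos: "(norm_Rn n w)\<^sup>2 > 0" by simp
    have "\<bar>defect n k 1 \<Psi> w w\<bar> / (norm_Rn n w)\<^sup>2 \<le> Inf D"
      using ne w pos unfolding D_def restricted_isometry_iff_defect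
      by (intro cInf_greatest) (auto simp: pos_divide_le_eq)
    then show ?thesis using pos by (simp add: pos_divide_le_eq)
  qed
  then have "restricted_isometry k n s \<Psi> (Inf D)"
    by (simp add: restricted_isometry_iff_defect)
  then show ?thesis
    by (simp add: restricted_isometry_constant_altdef D_def)
qed

lemma restricted_isometry_constant_le_iff:
  "restricted_isometry_constant k n s \<Psi> \<le> \<delta> \<longleftrightarrow> 0 \<le> \<delta> \<and> restricted_isometry k n s \<Psi> \<delta>"
proof
  assume "restricted_isometry_constant k n s \<Psi> \<le> \<delta>"
  then show "0 \<le> \<delta> \<and> restricted_isometry k n s \<Psi> \<delta>"
    using restricted_isometry_mono[OF restricted_isometry_constant_holds]
      order_trans[OF restricted_isometry_constant_nonneg] by blast
next
  assume "0 \<le> \<delta> \<and> restricted_isometry k n s \<Psi> \<delta>"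
  then show "restricted_isometry_constant k n s \<Psi> \<le> \<delta>"
    unfolding restricted_isometry_constant_altdef by (intro cInf_lower) (auto intro!: bdd_belowI[of _ 0])
qed

lemma restricted_isometry_constant_mono:
  "s' \<le> s \<Longrightarrow> restricted_isometry_constant k n s' \<Psi> \<le> restricted_isometry_constant k n s \<Psi>"
  by (simp add: restricted_isometry_constant_le_iff restricted_isometry_constant_nonneg
      restricted_isometry_subset[OF restricted_isometry_constant_holds])

section \<open>Iterative hard thresholding\<close>

definition precedes :: "rvec \<Rightarrow> nat \<Rightarrow> nat \<Rightarrow> bool" where
  "precedes v j i \<longleftrightarrow> \<bar>v i\<bar> < \<bar>v j\<bar> \<or> \<bar>v j\<bar> = \<bar>v i\<bar> \<and> j < i"

definition magnitude_rank :: "nat \<Rightarrow> rvec \<Rightarrow> nat \<Rightarrow> nat" where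
  "magnitude_rank n v i = card {j. j < n \<and> precedes v j i}"

definition largest_entries :: "nat \<Rightarrow> nat \<Rightarrow> rvec \<Rightarrow> nat set" where
  "largest_entries n s v = {i. i < n \<and> magnitude_rank n v i < s}"

lemma hard_threshold_altdef:
  "hard_threshold n s v i = (if i \<in> largest_entries n s v then v i else 0)"
  by (simp add: hard_threshold_def largest_entries_def magnitude_rank_def precedes_def)

lemma magnitude_rank_less:
  assumes "j < n" "precedes v j i"
  shows "magnitude_rank n v j < magnitude_rank n v i"
proof -
  have "precedes v l i" if "precedes v l j" for l
    using that assms(2) unfolding precedes_def by linarith
  moreover have "\<not> precedes v j j" by (simp add: precedes_def)
  ultimately show ?thesis
    unfolding magnitude_rank_def using assms by (intro psubset_card_mono) auto
qed

text \<open>\<open>precedes\<close> is a strict total order, so ranks are distinct, and an injection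
  of a finite set into itself is onto.\<close>

lemma magnitude_rank_bij: "bij_betw (magnitude_rank n v) {..<n} {..<n}"
proof -
  have inj: "inj_on (magnitude_rank n v) {..<n}"
  proof (rule inj_onI)
    fix i j assume ij: "i \<in> {..<n}" "j \<in> {..<n}" "magnitude_rank n v i = magnitude_rank n v j"
    have "i = j \<or> precedes v i j \<or> precedes v j i"
      unfolding precedes_def by linarith
    then show "i = j"
      using ij magnitude_rank_less[of i n v j] magnitude_rank_less[of j n v i] by auto
  qed
  have "magnitude_rank n v i < n" if "i < n" for i
  proof -
    have "magnitude_rank n v i < card {..<n}"
      unfolding magnitude_rank_def using that
      by (intro psubset_card_mono) (auto simp: precedes_def)
    then show ?thesis by simp
  qed
  then have "magnitude_rank n v ` {..<n} \<subseteq> {..<n}" by auto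
  with inj show ?thesis
    by (simp add: bij_betw_def endo_inj_surj)
qed

lemma finite_largest_entries [simp]: "finite (largest_entries n s v)"
  by (simp add: largest_entries_def)

text \<open>The rank is a bijection onto \<open>{..<n}\<close>, so each value below \<open>s\<close>
  is taken exactly once.\<close>

lemma card_largest_entries:
  assumes "s \<le> n"
  shows "card (largest_entries n s v) = s"
proof -
  have "bij_betw (magnitude_rank n v) (largest_entries n s v) {..<s}"
  proof (rule bij_betw_subset[OF magnitude_rank_bij[of n v]])
    show "magnitude_rank n v ` largest_entries n s v = {..<s}"
    proof safe
      fix r assume r: "r < s"
      then have "r \<in> magnitude_rank n v ` {..<n}"
        using magnitude_rank_bij[of n v] assms by (simp add: bij_betw_def)
      with r show "r \<in> magnitude_rank n v ` largest_entries n s v"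
        by (auto simp: largest_entries_def)
    qed (auto simp: largest_entries_def)
  qed (auto simp: largest_entries_def)
  then show ?thesis by (auto dest: bij_betw_same_card)
qed

lemma abs_le_largest_entry:
  assumes "i < n" "i \<notin> largest_entries n s v" "j \<in> largest_entries n s v"
  shows "\<bar>v i\<bar> \<le> \<bar>v j\<bar>"
proof (rule ccontr)
  assume "\<not> \<bar>v i\<bar> \<le> \<bar>v j\<bar>"
  then have "magnitude_rank n v i < magnitude_rank n v j"
    using assms by (intro magnitude_rank_less) (auto simp: precedes_def)
  with assms show False by (auto simp: largest_entries_def)
qed

text \<open>As \<open>S\<close> has at most as many elements as \<open>K\<close>, so has
  \<open>S - K\<close> compared with \<open>K - S\<close>. Every dropped entry can therefore be
  matched injectively with a kept one that is at least as large.\<close>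

lemma sum_dropped_le_sum_kept:
  fixes v :: rvec
  assumes "s \<le> n" "S \<subseteq> {..<n}" "card S \<le> s"
  defines "K \<equiv> largest_entries n s v"
  shows "(\<Sum>i\<in>S - K. (v i)\<^sup>2) \<le> (\<Sum>i\<in>K - S. (v i)\<^sup>2)"
proof -
  have fin: "finite S" using assms finite_subset by blast
  have finK: "finite K" by (simp add: K_def)
  have "card (S - K) + card (S \<inter> K) \<le> card (K - S) + card (S \<inter> K)"
    using assms card_largest_entries[of s n v] fin finK card_Int_Diff[of S K] card_Int_Diff[of K S]
    by (simp add: K_def Int_commute)
  then obtain h where h: "h ` (S - K) \<subseteq> K - S" "inj_on h (S - K)"
    using card_le_inj[of "S - K" "K - S"] fin finK by auto
  have "(\<Sum>i\<in>S - K. (v i)\<^sup>2) \<le> (\<Sum>i\<in>S - K. (v (h i))\<^sup>2)"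
  proof (rule sum_mono)
    fix i assume "i \<in> S - K"
    then have "\<bar>v i\<bar> \<le> \<bar>v (h i)\<bar>"
      using h(1) assms(2) unfolding K_def by (intro abs_le_largest_entry[of i n s v]) auto
    then show "(v i)\<^sup>2 \<le> (v (h i))\<^sup>2" by (simp add: abs_le_square_iff)
  qed
  also have "\<dots> = (\<Sum>i\<in>h ` (S - K). (v i)\<^sup>2)"
    using h(2) by (simp add: sum.reindex)
  also have "\<dots> \<le> (\<Sum>i\<in>K - S. (v i)\<^sup>2)"
    using h(1) finK by (intro sum_mono2) auto
  finally show ?thesis .
qed

lemma norm_Rn_restrict:
  assumes "B \<subseteq> {..<n}"
  shows "(norm_Rn n (\<lambda>i. if i \<in> B then v i else 0))\<^sup>2 = (\<Sum>i\<in>B. (v i)\<^sup>2)"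
proof -
  have "(norm_Rn n (\<lambda>i. if i \<in> B then v i else 0))\<^sup>2 = (\<Sum>i<n. if i \<in> B then (v i)\<^sup>2 else 0)"
    unfolding norm_Rn_sq by (intro sum.cong) auto
  then show ?thesis
    using assms by (simp add: sum.If_cases Int_absorb1)
qed

text \<open>On the entries in \<open>B\<close>, thresholding moves \<open>v\<close> at most as far as \<open>g\<close> is from \<open>v\<close>.\<close>

lemma hard_threshold_error:
  fixes v :: rvec
  assumes "s \<le> n" "S \<subseteq> {..<n}" "card S \<le> s" and g: "\<And>i. i < n \<Longrightarrow> i \<notin> S \<Longrightarrow> g i = 0"
  defines "B \<equiv> S \<union> largest_entries n s v"
  shows "norm_Rn n (\<lambda>i. hard_threshold n s v i - g i) \<le>
    2 * norm_Rn n (\<lambda>i. if i \<in> B then v i - g i else 0)"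
proof -
  define K where "K = largest_entries n s v"
  have K: "K \<subseteq> {..<n}" by (auto simp: K_def largest_entries_def)
  have B: "B \<subseteq> {..<n}" "finite B" "B = S \<union> K"
    using K assms(2) finite_subset[of _ "{..<n}"] by (auto simp: B_def K_def)
  have split: "hard_threshold n s v i - g i =
      (if i \<in> B then hard_threshold n s v i - v i else 0) + (if i \<in> B then v i - g i else 0)"
    if "i < n" for i
    using that g by (auto simp: B_def hard_threshold_altdef)
  have "(norm_Rn n (\<lambda>i. if i \<in> B then hard_threshold n s v i - v i else 0))\<^sup>2 =
      (\<Sum>i\<in>B. if i \<in> K then 0 else (v i)\<^sup>2)"
    unfolding norm_Rn_restrict[OF B(1)] by (intro sum.cong) (auto simp: hard_threshold_altdef K_def)
  also have "\<dots> = (\<Sum>i\<in>S - K. (v i)\<^sup>2)"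
    using B by (simp add: sum.If_cases Int_def) (intro sum.cong, auto)
  also have "\<dots> \<le> (\<Sum>i\<in>K - S. (v i)\<^sup>2)"
    unfolding K_def by (rule sum_dropped_le_sum_kept[OF assms(1-3)])
  \<comment> \<open>\<open>g\<close> vanishes off \<open>S\<close>, so there the entries of
    \<open>v\<close> are themselves errors.\<close>
  also have "\<dots> = (\<Sum>i\<in>K - S. (v i - g i)\<^sup>2)"
    using g K by (intro sum.cong) auto
  also have "\<dots> \<le> (\<Sum>i\<in>B. (v i - g i)\<^sup>2)"
    using B by (intro sum_mono2) auto
  also have "\<dots> = (norm_Rn n (\<lambda>i. if i \<in> B then v i - g i else 0))\<^sup>2"
    unfolding norm_Rn_restrict[OF B(1)] ..
  finally have "norm_Rn n (\<lambda>i. if i \<in> B then hard_threshold n s v i - v i else 0) \<le>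
      norm_Rn n (\<lambda>i. if i \<in> B then v i - g i else 0)"
    by (rule power2_le_imp_le) simp
  moreover have "norm_Rn n (\<lambda>i. hard_threshold n s v i - g i) = norm_Rn n (\<lambda>i.
      (if i \<in> B then hard_threshold n s v i - v i else 0) + (if i \<in> B then v i - g i else 0))"
    unfolding norm_Rn_def using split by (intro L2_set_cong) auto
  ultimately show ?thesis
    using norm_Rn_triangle[of n "\<lambda>i. if i \<in> B then hard_threshold n s v i - v i else 0"
        "\<lambda>i. if i \<in> B then v i - g i else 0"] by linarith
qed

section \<open>Contraction of the iteration\<close>

definition iht_map :: "nat \<Rightarrow> nat \<Rightarrow> nat \<Rightarrow> rmat \<Rightarrow> real \<Rightarrow> rvec \<Rightarrow> rvec \<Rightarrow> rvec" where
  "iht_map k n s \<Psi> \<mu> z y =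
     hard_threshold n s (\<lambda>i. y i + \<mu> * tmat_vec k \<Psi> (\<lambda>i. z i - mat_vec n \<Psi> y i) i)"

lemma fst_iht_iterate: "fst (iht_iterate M k n s \<Psi> \<mu> z T) = (iht_map k n s \<Psi> \<mu> z ^^ T) (\<lambda>_. 0)"
  by (induction T) (simp_all add: ret_def charge_def bind_costed_def iht_step_def iht_map_def)

lemma tmat_vec_cong: "(\<And>i. i < k \<Longrightarrow> u i = u' i) \<Longrightarrow> tmat_vec k \<Psi> u = tmat_vec k \<Psi> u'"
  by (simp add: tmat_vec_def)

text \<open>
  With step size \<open>1 / (1 + \<delta>\<^sub>s)\<close> the eigenvalues of the defect on \<open>3 s\<close> coordinates lie between
  \<open>- (\<delta> - \<delta>\<^sub>s) / (1 + \<delta>\<^sub>s)\<close> and \<open>(\<delta> + \<delta>\<^sub>s) / (1 + \<delta>\<^sub>s)\<close> for \<open>\<delta> = 1 / 15\<close>, so \<open>2 \<delta> / (1 + \<delta>) = 1 / 8\<close>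
  bounds them.
\<close>

lemma defect_le_eighth:
  assumes ric: "restricted_isometry_constant k n (3 * s) \<Psi> \<le> 1 / 15" and w: "sparse_vec n (3 * s) w"
  shows "\<bar>defect n k (1 / (1 + restricted_isometry_constant k n s \<Psi>)) \<Psi> w w\<bar> \<le> 1 / 8 * (norm_Rn n w)\<^sup>2"
proof -
  define \<delta> where "\<delta> = restricted_isometry_constant k n s \<Psi>"
  define P where "P = (norm_Rn k (mat_vec n \<Psi> w))\<^sup>2"
  define W where "W = (norm_Rn n w)\<^sup>2"
  have \<delta>: "0 \<le> \<delta>" "\<delta> \<le> 1 / 15"
    using ric restricted_isometry_constant_nonneg restricted_isometry_constant_mono[of s "3 * s" k n \<Psi>]
    unfolding \<delta>_def by auto
  have P: "(1 - 1 / 15) * W \<le> P" "P \<le> (1 + 1 / 15) * W"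
    using ric w unfolding restricted_isometry_constant_le_iff restricted_isometry_def P_def W_def by auto
  have W: "0 \<le> W" by (simp add: W_def)
  have \<delta>W: "0 \<le> \<delta> * W" "\<delta> * W \<le> 1 / 15 * W"
    using W \<delta> mult_right_mono[OF \<delta>(2) W] by auto
  have "defect n k (1 / (1 + \<delta>)) \<Psi> w w = W - P / (1 + \<delta>)"
    by (simp add: defect_self P_def W_def)
  also have "\<dots> = (W + \<delta> * W - P) / (1 + \<delta>)"
    using \<delta> by (simp add: field_simps)
  finally have eq: "defect n k (1 / (1 + \<delta>)) \<Psi> w w = (W + \<delta> * W - P) / (1 + \<delta>)" .
  \<comment> \<open>With the product as an atom the goal is linear in \<open>W\<close>,
    \<open>D\<close> and \<open>P\<close>. The bound on \<open>W + D - P\<close> is sharp for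
    \<open>D = W / 15\<close> and \<open>P = 14 / 15 * W\<close>.\<close>
  define D where "D = \<delta> * W"
  have "1 / 8 * W * (1 + \<delta>) = W / 8 + D / 8" by (simp add: D_def algebra_simps)
  then have "\<bar>W + \<delta> * W - P\<bar> \<le> 1 / 8 * W * (1 + \<delta>)"
    using P \<delta>W unfolding abs_le_iff D_def[symmetric] by simp
  then show ?thesis
    unfolding \<delta>_def[symmetric] W_def[symmetric] eq using \<delta> 
    by (simp add: abs_divide pos_divide_le_eq)
qed

text \<open>The factor \<open>1 / 8\<close> of the gradient step and the factor \<open>2\<close> of
  thresholding give \<open>1 / 4\<close>, which leaves room for \<open>1 / 2\<close>. The sparsity
  of \<open>y'\<close> allows the estimate to be iterated.\<close>

lemma iht_map_contracts:
  assumes "s \<le> n" and ric: "restricted_isometry_constant k n (3 * s) \<Psi> \<le> 1 / 15"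
    and S: "S \<subseteq> {..<n}" "card S \<le> s" and g: "\<And>i. i < n \<Longrightarrow> i \<notin> S \<Longrightarrow> g i = 0"
    and y: "sparse_vec n s y" and z: "\<And>i. i < k \<Longrightarrow> z i = mat_vec n \<Psi> g i"
  defines "y' \<equiv> iht_map k n s \<Psi> (1 / (1 + restricted_isometry_constant k n s \<Psi>)) z y"
  shows "sparse_vec n s y'"
    and "norm_Rn n (\<lambda>i. y' i - g i) \<le> norm_Rn n (\<lambda>i. y i - g i) / 2"
proof -
  define \<mu> where "\<mu> = 1 / (1 + restricted_isometry_constant k n s \<Psi>)"
  define r where "r = (\<lambda>i. y i - g i)"
  define a where "a = (\<lambda>i. y i + \<mu> * tmat_vec k \<Psi> (\<lambda>i. z i - mat_vec n \<Psi> y i) i)"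
  define K where "K = largest_entries n s a"
  define Y where "Y = {i. i < n \<and> y i \<noteq> 0}"
  have y': "y' = hard_threshold n s a"
    by (simp add: y'_def iht_map_def a_def \<mu>_def)
  have K: "K \<subseteq> {..<n}" "card K = s" "finite K"
    using card_largest_entries[OF \<open>s \<le> n\<close>, of a] by (auto simp: K_def largest_entries_def)
  have Y: "finite Y" "card Y \<le> s" using y by (auto simp: Y_def sparse_vec_def)
  have finS: "finite S" using S finite_subset by blast
  show "sparse_vec n s y'"
    unfolding sparse_vec_def y'
    by (rule order_trans[OF card_mono eq_refl[OF K(2)]])
      (auto simp: hard_threshold_altdef K_def)
  \<comment> \<open>Three index sets of size at most \<open>s\<close> are involved:
    \<open>S\<close>, which supports \<open>g\<close>, the kept entries \<open>K\<close>, and the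
    support \<open>Y\<close> of the current iterate. This is the origin of the order
    \<open>3 * s\<close>.\<close>
  define B where "B = S \<union> K"
  define U where "U = B \<union> Y"
  have "card U \<le> 3 * s"
    unfolding U_def B_def
    using card_Un_le[of "S \<union> K" Y] card_Un_le[of S K] K Y S by linarith
  moreover have "finite U" using finS K Y by (simp add: U_def B_def)
  ultimately have sparse: "sparse_vec n (3 * s) w" if "\<And>i. i < n \<Longrightarrow> i \<notin> U \<Longrightarrow> w i = 0" for w
    using that card_mono[of U "{i. i < n \<and> w i \<noteq> 0}"] unfolding sparse_vec_def by fastforce
  \<comment> \<open>The error after the gradient step, cut off outside \<open>B\<close>. Its squared
    norm is the inner product of the uncut error with \<open>e\<close>, hence a value of the form
    \<open>defect\<close>.\<close>
  define e where "e = (\<lambda>i. if i \<in> B then a i - g i else 0)"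
  have "mat_vec n \<Psi> r = (\<lambda>i. mat_vec n \<Psi> y i - mat_vec n \<Psi> g i)"
    unfolding r_def by (rule mat_vec_diff)
  then have "tmat_vec k \<Psi> (\<lambda>i. z i - mat_vec n \<Psi> y i) = tmat_vec k \<Psi> (\<lambda>i. - mat_vec n \<Psi> r i)"
    using z by (intro tmat_vec_cong) simp
  then have "a i - g i = r i - \<mu> * tmat_vec k \<Psi> (mat_vec n \<Psi> r) i" for i
    by (simp add: a_def r_def tmat_vec_def sum_negf)
  then have "inner_Rn n e e = (\<Sum>i<n. (r i - \<mu> * tmat_vec k \<Psi> (mat_vec n \<Psi> r) i) * e i)"
    unfolding inner_Rn_def by (intro sum.cong) (auto simp: e_def)
  also have "\<dots> = inner_Rn n r e - \<mu> * inner_Rn n (tmat_vec k \<Psi> (mat_vec n \<Psi> r)) e"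
    by (simp add: inner_Rn_def algebra_simps sum_subtractf sum_distrib_left)
  also have "\<dots> = defect n k \<mu> \<Psi> r e"
    by (simp add: inner_tmat_vec defect_def)
  finally have "(norm_Rn n e)\<^sup>2 = defect n k \<mu> \<Psi> r e"
    by (simp add: inner_Rn_self)
  also have "\<dots> \<le> \<bar>defect n k \<mu> \<Psi> r e\<bar>" by simp
  also have "\<dots> \<le> 1 / 8 * norm_Rn n r * norm_Rn n e"
  proof (rule abs_defect_le)
    show "\<bar>defect n k \<mu> \<Psi> w w\<bar> \<le> 1 / 8 * (norm_Rn n w)\<^sup>2" if "\<And>i. i < n \<Longrightarrow> i \<notin> U \<Longrightarrow> w i = 0" for w
      unfolding \<mu>_def using sparse[OF that] by (intro defect_le_eighth[OF ric])
    show "r i = 0" if "i < n" "i \<notin> U" for i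
      using that g by (auto simp: r_def U_def B_def Y_def)
    show "e i = 0" if "i < n" "i \<notin> U" for i
      using that by (auto simp: e_def U_def)
  qed
  finally have "norm_Rn n e * norm_Rn n e \<le> (1 / 8 * norm_Rn n r) * norm_Rn n e"
    by (simp add: power2_eq_square)
  then have "norm_Rn n e \<le> 1 / 8 * norm_Rn n r"
    using norm_Rn_nonneg[of n e] norm_Rn_nonneg[of n r] 
    by (cases "norm_Rn n e = 0") (auto simp: mult_le_cancel_right)
  moreover have "norm_Rn n (\<lambda>i. y' i - g i) \<le> 2 * norm_Rn n e"
    unfolding y' e_def B_def K_def by (rule hard_threshold_error[OF \<open>s \<le> n\<close> S g])
  ultimately show "norm_Rn n (\<lambda>i. y' i - g i) \<le> norm_Rn n (\<lambda>i. y i - g i) / 2"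
    using norm_Rn_nonneg[of n r] unfolding r_def by linarith
qed

lemma iht_recovery:
  assumes "s \<le> n" and ric: "restricted_isometry_constant k n (3 * s) \<Psi> \<le> 1 / 15"
    and S: "S \<subseteq> {..<n}" "card S \<le> s" and g: "\<And>i. i < n \<Longrightarrow> i \<notin> S \<Longrightarrow> g i = 0"
    and z: "\<And>i. i < k \<Longrightarrow> z i = mat_vec n \<Psi> g i"
  defines "y \<equiv> \<lambda>t. (iht_map k n s \<Psi> (1 / (1 + restricted_isometry_constant k n s \<Psi>)) z ^^ t) (\<lambda>_. 0)"
  shows "norm_Rn n (\<lambda>i. y t i - g i) \<le> norm_Rn n g / 2 ^ t"
proof -
  \<comment> \<open>Sparsity of the iterate is a premise of the contraction and is carried through
    the induction.\<close>
  have "sparse_vec n s (y t) \<and> norm_Rn n (\<lambda>i. y t i - g i) \<le> norm_Rn n g / 2 ^ t"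
  proof (induction t)
    case 0
    show ?case using norm_Rn_scale[of n "-1" g] by (simp add: y_def sparse_vec_def)
  next
    case (Suc t)
    have "y (Suc t) = iht_map k n s \<Psi> (1 / (1 + restricted_isometry_constant k n s \<Psi>)) z (y t)"
      by (simp add: y_def)
    with iht_map_contracts[OF \<open>s \<le> n\<close> ric S g _ z, of "y t"] Suc show ?case by simp
  qed
  then show ?thesis ..
qed

section \<open>Gradients, exact measurements and the cost of a run\<close>

lemma has_gradient_directional:
  assumes "has_gradient n f g x"
  shows "((\<lambda>t. f (\<lambda>i. x i + t * u i)) has_real_derivative inner_Rn n g u) (at 0)"
proof -
  have "(\<lambda>h. (f (\<lambda>i. x i + h * u i) - f x) / h) \<midarrow>0\<rightarrow> inner_Rn n g u"
  proof (rule LIM_I)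
    fix r :: real assume r: "r > 0"
    define N where "N = norm_Rn n u"
    have N: "N \<ge> 0" by (simp add: N_def)
    \<comment> \<open>\<open>N + 1\<close> in place of \<open>N\<close> avoids dividing by zero when
      \<open>u\<close> has norm zero.\<close>
    define e where "e = r / (2 * (N + 1))"
    have e: "e > 0" "e * N < r" 
    proof -
      show "e > 0" using r N by (simp add: e_def)
      have "r * N < r * (2 * (N + 1))" using r N by (intro mult_strict_left_mono) auto
      then show "e * N < r" using N by (simp add: e_def field_simps)
    qed
    obtain d where d: "d > 0" "\<And>h. norm_Rn n h < d \<Longrightarrow>
        \<bar>f (\<lambda>i. x i + h i) - f x - inner_Rn n g h\<bar> \<le> e * norm_Rn n h"
      using assms e(1) unfolding has_gradient_def by blast
    show "\<exists>s>0. \<forall>h. h \<noteq> 0 \<and> norm (h - 0) < s \<longrightarrow>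
        norm ((f (\<lambda>i. x i + h * u i) - f x) / h - inner_Rn n g u) < r"
    proof (intro exI[of _ "d / (N + 1)"] conjI allI impI)
      show "d / (N + 1) > 0" using d N by simp
      fix h :: real assume h: "h \<noteq> 0 \<and> norm (h - 0) < d / (N + 1)"
      then have "\<bar>h\<bar> * (N + 1) < d" using N by (simp add: field_simps)
      then have "norm_Rn n (\<lambda>i. h * u i) < d"
        using h by (simp add: norm_Rn_scale flip: N_def) (simp add: algebra_simps)
      then have "\<bar>f (\<lambda>i. x i + h * u i) - f x - inner_Rn n g (\<lambda>i. h * u i)\<bar> \<le> e * norm_Rn n (\<lambda>i. h * u i)"
        by (rule d(2))
      moreover have "inner_Rn n g (\<lambda>i. h * u i) = h * inner_Rn n g u"
        by (simp add: inner_Rn_def sum_distrib_left mult_ac)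
      ultimately have "\<bar>f (\<lambda>i. x i + h * u i) - f x - h * inner_Rn n g u\<bar> \<le> \<bar>h\<bar> * (e * N)"
        by (simp add: norm_Rn_scale N_def mult_ac)
      also have "\<dots> < \<bar>h\<bar> * r" using h e by simp
      finally have "\<bar>f (\<lambda>i. x i + h * u i) - f x - h * inner_Rn n g u\<bar> / \<bar>h\<bar> < r"
        using h by (simp add: field_simps)
      moreover have "(f (\<lambda>i. x i + h * u i) - f x) / h - inner_Rn n g u =
          (f (\<lambda>i. x i + h * u i) - f x - h * inner_Rn n g u) / h"
        using h by (simp add: field_simps)
      ultimately show "norm ((f (\<lambda>i. x i + h * u i) - f x) / h - inner_Rn n g u) < r"
        by (simp add: abs_divide)
    qed
  qed
  then show ?thesis by (simp add: DERIV_def)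
qed

text \<open>A partial derivative is a directional derivative along a unit vector, with the parameter
  shifted from \<open>0\<close> to \<open>x i\<close>.\<close>

lemma grad_eq_inner:
  assumes "has_gradient n f g x"
  shows "grad f x i = inner_Rn n g (\<lambda>j. if j = i then 1 else 0)"
proof -
  let ?e = "\<lambda>j. if j = i then 1 else (0::real)"
  have upd: "x(i := t) = (\<lambda>j. x j + (t - x i) * ?e j)" for t
    by auto
  have "((\<lambda>t. f (\<lambda>j. x j + (t - x i) * ?e j)) has_real_derivative inner_Rn n g ?e) (at (x i))"
    using DERIV_shift[of "\<lambda>t. f (\<lambda>j. x j + (t - x i) * ?e j)" _ 0 "x i"]
      has_gradient_directional[OF assms, of ?e] by simp
  then show ?thesis
    unfolding grad_def upd by (rule DERIV_imp_deriv)
qed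

lemma dir_deriv_eq_inner_grad:
  assumes "differentiable_Rn n f"
  shows "dir_deriv f x u = inner_Rn n (grad f x) u"
proof -
  obtain g where g: "has_gradient n f g x"
    using assms by (auto simp: differentiable_Rn_def)
  have "grad f x i = g i" if "i < n" for i
    using that unfolding grad_eq_inner[OF g] by (simp add: inner_Rn_def if_distrib sum.delta cong: if_cong)
  then have "inner_Rn n (grad f x) u = inner_Rn n g u"
    by (simp add: inner_Rn_def)
  then show ?thesis
    using DERIV_imp_deriv[OF has_gradient_directional[OF g, of u]] by (simp add: dir_deriv_def)
qed

lemma grad_sparse:
  assumes "\<forall>x y. (\<forall>i\<in>S. x i = y i) \<longrightarrow> f x = f y" "i \<notin> S"
  shows "grad f x i = 0"
proof -
  have "f (x(i := t)) = f x" for t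
    using assms by (metis fun_upd_apply)
  then show ?thesis by (simp add: grad_def)
qed

text \<open>The rows of \<open>\<Psi>\<close> serve as directions, so the measurements of the
  gradient are exact and recovery has no noise to deal with.\<close>

lemma fst_measurements:
  assumes "differentiable_Rn n f" "i < k"
  shows "fst (measurements \<xi> f x \<Psi> k) i = mat_vec n \<Psi> (grad f x) i"
  using \<open>i < k\<close>
proof (induction k)
  case (Suc k)
  then show ?case
    by (auto simp: bind_costed_def charge_def ret_def less_Suc_eq dir_deriv_eq_inner_grad[OF assms(1)]
        mat_vec_def inner_Rn_def mult.commute)
qed simp

lemma snd_measurements: "snd (measurements \<xi> f x \<Psi> k) = real k * \<xi>"
  by (induction k) (simp_all add: bind_costed_def charge_def ret_def algebra_simps)

lemma fst_iht:
  "fst (iht M \<xi> k n s T f x \<Psi>) =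
    (iht_map k n s \<Psi> (1 / (1 + restricted_isometry_constant k n s \<Psi>)) (fst (measurements \<xi> f x \<Psi> k)) ^^ T)
      (\<lambda>_. 0)"
  by (simp add: iht_def bind_costed_def charge_def fst_iht_iterate)

text \<open>The cost depends neither on the drawn matrix nor on the function, so it can be bounded
  for every outcome and not merely on average.\<close>

lemma snd_iht:
  "snd (iht M \<xi> k n s T f x \<Psi>) = real k * real n * sample_cost M + real k * \<xi> +
    real T * (2 * matvec_cost M k n + vecop_cost M k + 2 * vecop_cost M n + threshold_cost M n s)"
proof -
  have "snd (iht_iterate M k n s \<Psi> \<mu> z T) =
      real T * (2 * matvec_cost M k n + vecop_cost M k + 2 * vecop_cost M n + threshold_cost M n s)" for \<mu> z
    by (induction T) (simp_all add: ret_def charge_def bind_costed_def iht_step_def algebra_simps)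
  then show ?thesis
    by (simp add: iht_def bind_costed_def charge_def snd_measurements)
qed

section \<open>Gaussian matrices\<close>

text \<open>Coded by lists because integer lists form a countable type, over which quantification
  preserves measurability.\<close>

definition int_vec :: "int list \<Rightarrow> rvec" where
  "int_vec l = (\<lambda>i. if i < length l then real_of_int (l ! i) else 0)"

lemma norm_Rn_cong: "(\<And>i. i < n \<Longrightarrow> u i = u' i) \<Longrightarrow> norm_Rn n u = norm_Rn n u'"
  unfolding norm_Rn_def by (intro L2_set_cong) auto

lemma defect_scale: "defect n k \<mu> \<Psi> (\<lambda>i. c * u i) (\<lambda>i. c * u i) = c\<^sup>2 * defect n k \<mu> \<Psi> u u"
  unfolding defect_self mat_vec_scale norm_Rn_scale power_mult_distrib by (simp add: algebra_simps)

lemma tendsto_norm_Rn_sq: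
  assumes "\<And>i. i < n \<Longrightarrow> (\<lambda>m. u m i) \<longlonglongrightarrow> v i"
  shows "(\<lambda>m. (norm_Rn n (u m))\<^sup>2) \<longlonglongrightarrow> (norm_Rn n v)\<^sup>2"
  unfolding norm_Rn_sq using assms by (intro tendsto_sum tendsto_power) auto

lemma tendsto_defect_self:
  assumes "\<And>i. i < n \<Longrightarrow> (\<lambda>m. u m i) \<longlonglongrightarrow> v i"
  shows "(\<lambda>m. defect n k \<mu> \<Psi> (u m) (u m)) \<longlonglongrightarrow> defect n k \<mu> \<Psi> v v"
  unfolding defect_self mat_vec_def
  using assms by (intro tendsto_diff tendsto_mult tendsto_const tendsto_norm_Rn_sq tendsto_sum) auto

lemma tendsto_floor_scale: "(\<lambda>m. real_of_int \<lfloor>real (Suc m) * x\<rfloor> / real (Suc m)) \<longlonglongrightarrow> x"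
proof (rule tendsto_sandwich)
  show "\<forall>\<^sub>F m in sequentially. x - 1 / real (Suc m) \<le> real_of_int \<lfloor>real (Suc m) * x\<rfloor> / real (Suc m)"
  proof (rule always_eventually, rule allI)
    fix m
    have "real (Suc m) * x - 1 \<le> real_of_int \<lfloor>real (Suc m) * x\<rfloor>" by linarith
    then have "(real (Suc m) * x - 1) / real (Suc m) \<le> real_of_int \<lfloor>real (Suc m) * x\<rfloor> / real (Suc m)"
      by (rule divide_right_mono) simp
    then show "x - 1 / real (Suc m) \<le> real_of_int \<lfloor>real (Suc m) * x\<rfloor> / real (Suc m)"
      by (simp add: diff_divide_distrib del: of_nat_Suc)
  qed
  show "\<forall>\<^sub>F m in sequentially. real_of_int \<lfloor>real (Suc m) * x\<rfloor> / real (Suc m) \<le> x"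
  proof (rule always_eventually, rule allI)
    fix m
    have "real_of_int \<lfloor>real (Suc m) * x\<rfloor> \<le> real (Suc m) * x" by linarith
    then show "real_of_int \<lfloor>real (Suc m) * x\<rfloor> / real (Suc m) \<le> x"
      by (simp add: field_simps del: of_nat_Suc)
  qed
  show "(\<lambda>m. x - 1 / real (Suc m)) \<longlonglongrightarrow> x"
    using tendsto_diff[OF tendsto_const LIMSEQ_inverse_real_of_nat, of x] by (simp add: inverse_eq_divide)
qed simp

lemma sparse_vec_zeros:
  "sparse_vec n s w \<Longrightarrow> (\<And>i. i < n \<Longrightarrow> w i = 0 \<Longrightarrow> w' i = 0) \<Longrightarrow> sparse_vec n s w'"
  unfolding sparse_vec_def
  using card_mono[of "{i. i < n \<and> w i \<noteq> 0}" "{i. i < n \<and> w' i \<noteq> 0}"] by fastforce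

text \<open>By homogeneity and continuity, integer vectors suffice; there are only countably many.\<close>

lemma restricted_isometry_iff_int_vec:
  "restricted_isometry k n s \<Psi> \<delta> \<longleftrightarrow> (\<forall>l. sparse_vec n s (int_vec l) \<longrightarrow>
     \<bar>defect n k 1 \<Psi> (int_vec l) (int_vec l)\<bar> \<le> \<delta> * (norm_Rn n (int_vec l))\<^sup>2)"
  unfolding restricted_isometry_iff_defect
proof safe
  fix w
  assume l: "\<forall>l. sparse_vec n s (int_vec l) \<longrightarrow>
     \<bar>defect n k 1 \<Psi> (int_vec l) (int_vec l)\<bar> \<le> \<delta> * (norm_Rn n (int_vec l))\<^sup>2"
    and w: "sparse_vec n s w"
  \<comment> \<open>Scaling by \<open>m + 1\<close>, rounding down and scaling back converges to
    \<open>w\<close>. Zero entries stay zero, so sparsity is inherited.\<close>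
  define u where "u m = (\<lambda>i. (1 / real (Suc m)) * int_vec (map (\<lambda>i. \<lfloor>real (Suc m) * w i\<rfloor>) [0..<n]) i)" for m
  have lim: "(\<lambda>m. u m i) \<longlonglongrightarrow> w i" if "i < n" for i
    using tendsto_floor_scale[of "w i"] that by (simp add: u_def int_vec_def)
  have "\<bar>defect n k 1 \<Psi> (u m) (u m)\<bar> \<le> \<delta> * (norm_Rn n (u m))\<^sup>2" for m
  proof -
    have "sparse_vec n s (int_vec (map (\<lambda>i. \<lfloor>real (Suc m) * w i\<rfloor>) [0..<n]))"
      by (rule sparse_vec_zeros[OF w]) (simp add: int_vec_def)
    then show ?thesis
      using l unfolding u_def defect_scale norm_Rn_scale power_mult_distrib abs_mult
      by (simp add: mult.left_commute[of \<delta>] divide_right_mono del: of_nat_Suc)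
  qed
  then show "\<bar>defect n k 1 \<Psi> w w\<bar> \<le> \<delta> * (norm_Rn n w)\<^sup>2"
    by (intro LIMSEQ_le[OF tendsto_rabs[OF tendsto_defect_self[of n u w]]
          tendsto_mult[OF tendsto_const tendsto_norm_Rn_sq[of n u w]]] lim) auto
qed blast

section \<open>Measurability, independence and distribution of Gaussian measurements\<close>

abbreviation gaussian_entry :: "nat \<Rightarrow> real measure" where
  "gaussian_entry k \<equiv> density lborel (normal_density 0 (1 / sqrt (real k)))"

lemma prob_space_gaussian_entry: "0 < k \<Longrightarrow> prob_space (gaussian_entry k)"
  by (rule prob_space_normal_density) simp

lemma prob_space_gaussian_matrix: "0 < k \<Longrightarrow> prob_space (gaussian_matrix k n)"
  unfolding gaussian_matrix_def by (intro prob_space_PiM prob_space_gaussian_entry)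

lemma measurable_gaussian_entry:
  assumes "i < k" "j < n"
  shows "(\<lambda>\<Psi>. \<Psi> (i, j)) \<in> borel_measurable (gaussian_matrix k n)"
proof -
  have "(\<lambda>\<Psi>. \<Psi> (i, j)) \<in> gaussian_matrix k n \<rightarrow>\<^sub>M gaussian_entry k"
    unfolding gaussian_matrix_def using assms by (intro measurable_component_singleton) simp
  then show ?thesis by simp
qed

lemma measurable_mat_vec:
  assumes "i < k" "\<And>j. j < n \<Longrightarrow> (\<lambda>\<Psi>. w \<Psi> j) \<in> borel_measurable (gaussian_matrix k n)"
  shows "(\<lambda>\<Psi>. mat_vec n \<Psi> (w \<Psi>) i) \<in> borel_measurable (gaussian_matrix k n)"
  unfolding mat_vec_def using assms
  by (intro borel_measurable_sum borel_measurable_times measurable_gaussian_entry) auto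

lemma measurable_tmat_vec:
  assumes "j < n" "\<And>i. i < k \<Longrightarrow> (\<lambda>\<Psi>. u \<Psi> i) \<in> borel_measurable (gaussian_matrix k n)"
  shows "(\<lambda>\<Psi>. tmat_vec k \<Psi> (u \<Psi>) j) \<in> borel_measurable (gaussian_matrix k n)"
  unfolding tmat_vec_def using assms
  by (intro borel_measurable_sum borel_measurable_times measurable_gaussian_entry) auto

lemma measurable_norm_mat_vec:
  "(\<lambda>\<Psi>. (norm_Rn k (mat_vec n \<Psi> w))\<^sup>2) \<in> borel_measurable (gaussian_matrix k n)"
  unfolding norm_Rn_sq by (intro borel_measurable_sum borel_measurable_power measurable_mat_vec) auto

lemma measurable_defect:
  "(\<lambda>\<Psi>. defect n k \<mu> \<Psi> w w) \<in> borel_measurable (gaussian_matrix k n)"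
  unfolding defect_self
  by (intro borel_measurable_diff borel_measurable_times borel_measurable_const measurable_norm_mat_vec)

text \<open>A sublevel set for \<open>a \<ge> 0\<close> is a countable intersection of conditions on
  \<open>defect\<close> at integer vectors; for negative \<open>a\<close> it is empty.\<close>

lemma measurable_restricted_isometry_constant:
  "restricted_isometry_constant k n s \<in> borel_measurable (gaussian_matrix k n)"
proof (rule borel_measurable_iff_le[THEN iffD2], rule allI)
  fix a
  have "Measurable.pred (gaussian_matrix k n) (\<lambda>\<Psi>. restricted_isometry k n s \<Psi> a)"
    unfolding restricted_isometry_iff_int_vec using measurable_defect[measurable] by measurable
  then show "{\<Psi> \<in> space (gaussian_matrix k n). restricted_isometry_constant k n s \<Psi> \<le> a}
      \<in> sets (gaussian_matrix k n)"
    unfolding restricted_isometry_constant_le_iff pred_def by (cases "0 \<le> a") simp_all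
qed

text \<open>Independence means that the joint law is the product of the marginals; on the space of
  the product measure \<open>restrict\<close> is the identity.\<close>

lemma indep_vars_gaussian_matrix:
  assumes "0 < k" "0 < n"
  shows "prob_space.indep_vars (gaussian_matrix k n) (\<lambda>_. borel) (\<lambda>p \<Psi>. \<Psi> p) ({..<k} \<times> {..<n})"
proof -
  interpret G: prob_space "gaussian_matrix k n"
    by (rule prob_space_gaussian_matrix[OF assms(1)])
  let ?I = "{..<k} \<times> {..<n}"
  have "G.indep_vars (\<lambda>_. gaussian_entry k) (\<lambda>p \<Psi>. \<Psi> p) ?I"
  proof (subst G.indep_vars_iff_distr_eq_PiM')
    show "?I \<noteq> {}" using assms by auto
    show "(\<lambda>\<Psi>. \<Psi> p) \<in> gaussian_matrix k n \<rightarrow>\<^sub>M gaussian_entry k" if "p \<in> ?I" for p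
      unfolding gaussian_matrix_def using that by (rule measurable_component_singleton)
    have "distr (gaussian_matrix k n) (Pi\<^sub>M ?I (\<lambda>_. gaussian_entry k)) (\<lambda>\<Psi>. restrict \<Psi> ?I) =
        distr (gaussian_matrix k n) (gaussian_matrix k n) (\<lambda>\<Psi>. \<Psi>)"
      unfolding gaussian_matrix_def
      by (intro distr_cong refl) (simp add: space_PiM PiE_restrict)
    also have "\<dots> = gaussian_matrix k n" by (rule distr_id)
    also have "\<dots> = (\<Pi>\<^sub>M p\<in>?I. distr (gaussian_matrix k n) (gaussian_entry k) (\<lambda>\<Psi>. \<Psi> p))"
      unfolding gaussian_matrix_def
      using assms by (intro PiM_cong refl distr_PiM_component[symmetric] prob_space_gaussian_entry) auto
    finally show "distr (gaussian_matrix k n) (Pi\<^sub>M ?I (\<lambda>_. gaussian_entry k)) (\<lambda>\<Psi>. \<lambda>p\<in>?I. \<Psi> p) =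
      (\<Pi>\<^sub>M p\<in>?I. distr (gaussian_matrix k n) (gaussian_entry k) (\<lambda>\<Psi>. \<Psi> p))" .
  qed
  then show ?thesis
    by (rule G.indep_vars_compose2[where Y = "\<lambda>_ x. x"]) simp
qed

lemma distributed_gaussian_entry:
  assumes "0 < k" "i < k" "j < n"
  shows "distributed (gaussian_matrix k n) lborel (\<lambda>\<Psi>. \<Psi> (i, j)) (normal_density 0 (1 / sqrt (real k)))"
proof -
  have "distr (gaussian_matrix k n) lborel (\<lambda>\<Psi>. \<Psi> (i, j)) =
      distr (gaussian_matrix k n) (gaussian_entry k) (\<lambda>\<Psi>. \<Psi> (i, j))"
    by (intro distr_cong) simp_all
  also have "\<dots> = gaussian_entry k"
    unfolding gaussian_matrix_def using assms
    by (intro distr_PiM_component prob_space_gaussian_entry) auto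
  finally show ?thesis
    using measurable_gaussian_entry[OF assms(2,3)] by (simp add: distributed_def)
qed

lemma distributed_mat_vec:
  assumes "i < k" "norm_Rn n w \<noteq> 0"
  shows "distributed (gaussian_matrix k n) lborel (\<lambda>\<Psi>. mat_vec n \<Psi> w i)
           (normal_density 0 (norm_Rn n w / sqrt (real k)))"
proof -
  have k: "0 < k" using assms by simp
  interpret G: prob_space "gaussian_matrix k n"
    by (rule prob_space_gaussian_matrix[OF k])
  \<comment> \<open>A zero coefficient would contribute a degenerate normal variable, which has no
    density, so only nonzero coefficients are summed.\<close>
  define J where "J = {j. j < n \<and> w j \<noteq> 0}"
  have J: "finite J" "J \<noteq> {}" "J \<subseteq> {..<n}"
    using assms(2) by (auto simp: J_def norm_Rn_eq_0_iff)
  then have n: "0 < n" by auto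
  have pairs: "{i} \<times> J = Pair i ` J" by auto
  have "distributed (gaussian_matrix k n) lborel (\<lambda>\<Psi>. \<Sum>p\<in>{i} \<times> J. w (snd p) * \<Psi> p)
      (normal_density (\<Sum>p\<in>{i} \<times> J. 0) (sqrt (\<Sum>p\<in>{i} \<times> J. (\<bar>w (snd p)\<bar> * (1 / sqrt (real k)))\<^sup>2)))"
  proof (rule G.sum_indep_normal)
    show "G.indep_vars (\<lambda>_. borel) (\<lambda>p \<Psi>. w (snd p) * \<Psi> p) ({i} \<times> J)"
      by (rule G.indep_vars_compose2[OF G.indep_vars_subset[OF indep_vars_gaussian_matrix[OF k n]]])
        (use assms J in auto)
    show "0 < \<bar>w (snd p)\<bar> * (1 / sqrt (real k))" if "p \<in> {i} \<times> J" for p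
      using that k by (auto simp: J_def)
    show "distributed (gaussian_matrix k n) lborel (\<lambda>\<Psi>. w (snd p) * \<Psi> p)
        (normal_density 0 (\<bar>w (snd p)\<bar> * (1 / sqrt (real k))))" if "p \<in> {i} \<times> J" for p
    proof -
      obtain j where p: "p = (i, j)" "j < n" "w j \<noteq> 0"
        using \<open>p \<in> {i} \<times> J\<close> by (auto simp: J_def)
      show ?thesis
        using G.normal_density_affine[OF distributed_gaussian_entry[OF k assms(1) p(2)] _ p(3), of 0] k
        by (simp add: p(1))
    qed
  qed (use J in auto)
  moreover have "(\<Sum>p\<in>{i} \<times> J. w (snd p) * \<Psi> p) = mat_vec n \<Psi> w i" for \<Psi>
  proof -
    have "(\<Sum>p\<in>{i} \<times> J. w (snd p) * \<Psi> p) = (\<Sum>j\<in>J. \<Psi> (i, j) * w j)"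
      unfolding pairs by (simp add: sum.reindex inj_on_def mult.commute)
    also have "\<dots> = (\<Sum>j<n. \<Psi> (i, j) * w j)"
      using J by (intro sum.mono_neutral_left) (auto simp: J_def)
    finally show ?thesis by (simp add: mat_vec_def)
  qed
  moreover have "sqrt (\<Sum>p\<in>{i} \<times> J. (\<bar>w (snd p)\<bar> * (1 / sqrt (real k)))\<^sup>2) = norm_Rn n w / sqrt (real k)"
  proof -
    have "(\<Sum>p\<in>{i} \<times> J. (\<bar>w (snd p)\<bar> * (1 / sqrt (real k)))\<^sup>2) = (\<Sum>j\<in>J. (w j)\<^sup>2 / real k)"
      unfolding pairs by (simp add: sum.reindex inj_on_def power_mult_distrib power_divide)
    also have "\<dots> = (\<Sum>j<n. (w j)\<^sup>2 / real k)"
      using J by (intro sum.mono_neutral_left) (auto simp: J_def)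
    also have "\<dots> = (norm_Rn n w)\<^sup>2 / real k"
      by (simp add: norm_Rn_sq sum_divide_distrib)
    finally show ?thesis by (simp add: real_sqrt_divide)
  qed
  ultimately show ?thesis by simp
qed

text \<open>Different rows use disjoint blocks of independent entries.\<close>

lemma indep_vars_mat_vec:
  assumes "0 < k" "0 < n"
  shows "prob_space.indep_vars (gaussian_matrix k n) (\<lambda>_. borel) (\<lambda>i \<Psi>. mat_vec n \<Psi> w i) {..<k}"
proof -
  interpret G: prob_space "gaussian_matrix k n"
    by (rule prob_space_gaussian_matrix[OF assms(1)])
  let ?K = "\<lambda>i. {i} \<times> {..<n}"
  have "G.indep_vars (\<lambda>i. Pi\<^sub>M (?K i) (\<lambda>_. borel)) (\<lambda>i \<Psi>. restrict (\<lambda>p. \<Psi> p) (?K i)) {..<k}"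
    by (rule G.indep_vars_restrict[OF indep_vars_gaussian_matrix[OF assms]])
      (auto simp: disjoint_family_on_def)
  then have "G.indep_vars (\<lambda>_. borel)
      (\<lambda>i \<Psi>. (\<lambda>\<omega>. \<Sum>j<n. \<omega> (i, j) * w j) (restrict (\<lambda>p. \<Psi> p) (?K i))) {..<k}"
    by (rule G.indep_vars_compose2)
      (intro borel_measurable_sum borel_measurable_times borel_measurable_const measurable_component_singleton, auto)
  then show ?thesis by (simp add: mat_vec_def)
qed

text \<open>The factor \<open>exp (\<theta> * x^2)\<close> turns the normal density into another
  centred normal density with a changed variance; the ratio of the normalising constants is the
  value of the integral.\<close>

lemma nn_integral_exp_normal_sq:
  assumes X: "distributed M lborel X (normal_density 0 \<tau>)" and "0 < \<tau>" and \<theta>: "2 * \<theta> * \<tau>\<^sup>2 < 1"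
  shows "(\<integral>\<^sup>+\<omega>. exp (\<theta> * (X \<omega>)\<^sup>2) \<partial>M) = 1 / sqrt (1 - 2 * \<theta> * \<tau>\<^sup>2)"
proof -
  define a where "a = 1 - 2 * \<theta> * \<tau>\<^sup>2"
  have a: "a > 0" using \<theta> by (simp add: a_def)
  define \<tau>' where "\<tau>' = \<tau> / sqrt a"
  have \<tau>': "\<tau>' > 0" using a assms(2) by (simp add: \<tau>'_def)
  have "normal_density 0 \<tau> x * exp (\<theta> * x\<^sup>2) = 1 / sqrt a * normal_density 0 \<tau>' x" for x
  proof -
    have "- x\<^sup>2 / (2 * \<tau>\<^sup>2) + \<theta> * x\<^sup>2 = - x\<^sup>2 / (2 * \<tau>'\<^sup>2)"
      using a assms(2) by (simp add: \<tau>'_def power_divide field_simps) (simp add: a_def field_simps)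
    then have "exp (- x\<^sup>2 / (2 * \<tau>\<^sup>2)) * exp (\<theta> * x\<^sup>2) = exp (- x\<^sup>2 / (2 * \<tau>'\<^sup>2))"
      by (simp flip: exp_add)
    moreover have "1 / sqrt (2 * pi * \<tau>\<^sup>2) = 1 / sqrt a * (1 / sqrt (2 * pi * \<tau>'\<^sup>2))"
      using a assms(2) by (simp add: \<tau>'_def power_divide real_sqrt_mult real_sqrt_divide)
    ultimately show ?thesis by (simp add: normal_density_def mult.assoc)
  qed
  note eq = this
  have "(\<integral>\<^sup>+\<omega>. exp (\<theta> * (X \<omega>)\<^sup>2) \<partial>M) = (\<integral>\<^sup>+x. ennreal (normal_density 0 \<tau> x) * exp (\<theta> * x\<^sup>2) \<partial>lborel)"
    by (rule distributed_nn_integral[OF X, symmetric]) simp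
  also have "\<dots> = (\<integral>\<^sup>+x. ennreal (1 / sqrt a) * ennreal (normal_density 0 \<tau>' x) \<partial>lborel)"
    using a by (intro nn_integral_cong) (simp add: eq flip: ennreal_mult' ennreal_mult'')
  also have "\<dots> = ennreal (1 / sqrt a) * (\<integral>\<^sup>+x. ennreal (normal_density 0 \<tau>' x) \<partial>lborel)"
    by (rule nn_integral_cmult) simp
  also have "(\<integral>\<^sup>+x. ennreal (normal_density 0 \<tau>' x) \<partial>lborel) = 1"
    using prob_space.emeasure_space_1[OF prob_space_normal_density[OF \<tau>', of 0]]
    by (simp add: emeasure_density)
  finally show ?thesis by (simp add: a_def)
qed

text \<open>The moment generating function \<open>(1 - 2 l) powr (- k / 2)\<close> of a chi-squared
  variable with \<open>k\<close> degrees of freedom. It is needed for \<open>l\<close> of both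
  signs, one for each tail.\<close>

lemma nn_integral_exp_norm_mat_vec:
  assumes "0 < k" "norm_Rn n w \<noteq> 0" and l: "2 * l < 1"
  shows "(\<integral>\<^sup>+\<Psi>. exp (l * real k / (norm_Rn n w)\<^sup>2 * (norm_Rn k (mat_vec n \<Psi> w))\<^sup>2) \<partial>gaussian_matrix k n) =
    exp (- (real k / 2) * ln (1 - 2 * l))"
proof -
  interpret G: prob_space "gaussian_matrix k n"
    by (rule prob_space_gaussian_matrix[OF assms(1)])
  have n: "0 < n" using assms(2) by (auto simp: norm_Rn_eq_0_iff)
  define \<tau> where "\<tau> = norm_Rn n w / sqrt (real k)"
  define \<theta> where "\<theta> = l * real k / (norm_Rn n w)\<^sup>2"
  have "norm_Rn n w > 0" using assms(2) norm_Rn_nonneg[of n w] by linarith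
  then have \<tau>: "\<tau> > 0" using assms(1) by (simp add: \<tau>_def)
  have \<theta>: "2 * \<theta> * \<tau>\<^sup>2 = 2 * l" using assms by (simp add: \<theta>_def \<tau>_def power_divide)
  have "(\<integral>\<^sup>+\<Psi>. exp (\<theta> * (norm_Rn k (mat_vec n \<Psi> w))\<^sup>2) \<partial>gaussian_matrix k n) =
      (\<integral>\<^sup>+\<Psi>. (\<Prod>i<k. ennreal (exp (\<theta> * (mat_vec n \<Psi> w i)\<^sup>2))) \<partial>gaussian_matrix k n)"
    unfolding norm_Rn_sq[of k] sum_distrib_left by (simp add: exp_sum prod_ennreal)
  also have "\<dots> = (\<Prod>i<k. \<integral>\<^sup>+\<Psi>. ennreal (exp (\<theta> * (mat_vec n \<Psi> w i)\<^sup>2)) \<partial>gaussian_matrix k n)"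
    by (intro G.indep_vars_nn_integral G.indep_vars_compose2[OF indep_vars_mat_vec[OF assms(1) n]]) auto
  also have "\<dots> = (\<Prod>i<k. ennreal (1 / sqrt (1 - 2 * l)))"
  proof (intro prod.cong refl)
    fix i assume "i \<in> {..<k}"
    then have "distributed (gaussian_matrix k n) lborel (\<lambda>\<Psi>. mat_vec n \<Psi> w i) (normal_density 0 \<tau>)"
      unfolding \<tau>_def using assms(2) by (intro distributed_mat_vec) auto
    from nn_integral_exp_normal_sq[OF this \<tau>, of \<theta>] l
    show "(\<integral>\<^sup>+\<Psi>. ennreal (exp (\<theta> * (mat_vec n \<Psi> w i)\<^sup>2)) \<partial>gaussian_matrix k n) =
        ennreal (1 / sqrt (1 - 2 * l))"
      by (simp add: \<theta>)
  qed
  also have "\<dots> = ennreal ((1 / sqrt (1 - 2 * l)) ^ k)"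
    using l by (simp add: ennreal_power)
  also have "1 / sqrt (1 - 2 * l) = exp (- ln (1 - 2 * l) / 2)"
    using l by (simp add: exp_minus ln_sqrt[symmetric] inverse_eq_divide)
  also have "exp (- ln (1 - 2 * l) / 2) ^ k = exp (- (real k / 2) * ln (1 - 2 * l))"
    by (simp flip: exp_of_nat_mult)
  finally show ?thesis by (simp add: \<theta>_def)
qed

lemma gaussian_concentration:
  assumes "0 < k" "norm_Rn n w \<noteq> 0" and t: "0 < t" "t \<le> 1"
  shows "measure (gaussian_matrix k n)
      {\<Psi> \<in> space (gaussian_matrix k n). t * (norm_Rn n w)\<^sup>2 < \<bar>defect n k 1 \<Psi> w w\<bar>} \<le>
    2 * exp (- real k * t\<^sup>2 / 16)"
proof -
  let ?G = "gaussian_matrix k n"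
  interpret G: prob_space ?G
    by (rule prob_space_gaussian_matrix[OF assms(1)])
  define W where "W = (norm_Rn n w)\<^sup>2"
  define X where "X = (\<lambda>\<Psi>. (norm_Rn k (mat_vec n \<Psi> w))\<^sup>2)"
  have W: "W > 0" using assms by (simp add: W_def)
  \<comment> \<open>This \<open>l\<close> minimises \<open>4 * l^2 - t * l\<close>, the bound on the
    exponent per row in the upper tail. In the lower tail it yields \<open>3 / 32\<close> in place
    of \<open>1 / 16\<close>, which is better.\<close>
  define l where "l = t / 8"
  define \<theta> where "\<theta> = l * real k / W"
  have l: "0 < l" "2 * l < 1" "2 * l \<le> 1 / 2" using t by (auto simp: l_def)
  have \<theta>: "\<theta> > 0" "\<theta> * W = l * real k" using l W assms(1) by (auto simp: \<theta>_def)
  have X [measurable]: "X \<in> borel_measurable ?G"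
    unfolding X_def by (rule measurable_norm_mat_vec)
  have *: "(\<integral>\<^sup>+\<Psi>. ennreal (exp (c * X \<Psi>)) * indicator (space ?G) \<Psi> \<partial>?G) =
      (\<integral>\<^sup>+\<Psi>. ennreal (exp (c * X \<Psi>)) \<partial>?G)" for c
    by (intro nn_integral_cong) simp
  have "emeasure ?G {\<Psi> \<in> space ?G. (1 + t) * W \<le> X \<Psi>} \<le>
      ennreal (exp (- \<theta> * ((1 + t) * W))) * (\<integral>\<^sup>+\<Psi>. ennreal (exp (\<theta> * X \<Psi>)) \<partial>?G)"
    using Chernoff_ineq_nn_integral_ge[OF \<theta>(1), of "space ?G" ?G X] by (simp add: *)
  also have "\<dots> = ennreal (exp (- \<theta> * ((1 + t) * W) + - (real k / 2) * ln (1 - 2 * l)))"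
    unfolding exp_add using nn_integral_exp_norm_mat_vec[OF assms(1,2) l(2)]
    by (simp add: \<theta>_def X_def W_def ennreal_mult')
  also have "\<dots> \<le> ennreal (exp (- real k * t\<^sup>2 / 16))"
  proof -
    have "- (2 * l) - 2 * (2 * l)\<^sup>2 \<le> ln (1 - 2 * l)"
      using l by (intro ln_one_minus_pos_lower_bound) auto
    then have "- (real k / 2) * ln (1 - 2 * l) \<le> - (real k / 2) * (- (2 * l) - 2 * (2 * l)\<^sup>2)"
      by (intro mult_left_mono_neg) auto
    moreover have "\<theta> * ((1 + t) * W) = (1 + t) * (l * real k)"
      using \<theta>(2) by (simp add: mult.left_commute)
    moreover have "- ((1 + t) * (l * real k)) + - (real k / 2) * (- (2 * l) - 2 * (2 * l)\<^sup>2) = - real k * t\<^sup>2 / 16"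
      by (simp add: l_def power2_eq_square field_simps)
    ultimately show ?thesis
      by (intro ennreal_leI iffD2[OF exp_le_cancel_iff]) linarith
  qed
  finally have upper: "measure ?G {\<Psi> \<in> space ?G. (1 + t) * W \<le> X \<Psi>} \<le> exp (- real k * t\<^sup>2 / 16)"
    by (simp add: G.emeasure_eq_measure)
  have "emeasure ?G {\<Psi> \<in> space ?G. X \<Psi> \<le> (1 - t) * W} \<le>
      ennreal (exp (\<theta> * ((1 - t) * W))) * (\<integral>\<^sup>+\<Psi>. ennreal (exp (- \<theta> * X \<Psi>)) \<partial>?G)"
    using Chernoff_ineq_nn_integral_le[OF \<theta>(1), of "space ?G" ?G X "(1 - t) * W"] *[of "- \<theta>"] by simp
  also have "\<dots> = ennreal (exp (\<theta> * ((1 - t) * W) + - (real k / 2) * ln (1 + 2 * l)))"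
    unfolding exp_add using nn_integral_exp_norm_mat_vec[OF assms(1,2), of "- l"] l
    by (simp add: \<theta>_def X_def W_def ennreal_mult')
  also have "\<dots> \<le> ennreal (exp (- real k * t\<^sup>2 / 16))"
  proof -
    have "2 * l - (2 * l)\<^sup>2 \<le> ln (1 + 2 * l)"
      using l by (intro ln_one_plus_pos_lower_bound) auto
    then have "- (real k / 2) * ln (1 + 2 * l) \<le> - (real k / 2) * (2 * l - (2 * l)\<^sup>2)"
      by (intro mult_left_mono_neg) auto
    moreover have "\<theta> * ((1 - t) * W) = (1 - t) * (l * real k)"
      using \<theta>(2) by (simp add: mult.left_commute)
    moreover have "(1 - t) * (l * real k) + - (real k / 2) * (2 * l - (2 * l)\<^sup>2) = - (3 * (real k * t\<^sup>2) / 32)"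
      by (simp add: l_def power2_eq_square field_simps)
    moreover have "0 \<le> real k * t\<^sup>2" by simp
    ultimately show ?thesis
      by (intro ennreal_leI iffD2[OF exp_le_cancel_iff]) linarith
  qed
  finally have lower: "measure ?G {\<Psi> \<in> space ?G. X \<Psi> \<le> (1 - t) * W} \<le> exp (- real k * t\<^sup>2 / 16)"
    by (simp add: G.emeasure_eq_measure)
  have "{\<Psi> \<in> space ?G. t * W < \<bar>defect n k 1 \<Psi> w w\<bar>} \<subseteq>
      {\<Psi> \<in> space ?G. (1 + t) * W \<le> X \<Psi>} \<union> {\<Psi> \<in> space ?G. X \<Psi> \<le> (1 - t) * W}"
    by (auto simp: defect_self X_def[symmetric] W_def[symmetric] algebra_simps X_def[THEN fun_cong, symmetric])
  then have "measure ?G {\<Psi> \<in> space ?G. t * W < \<bar>defect n k 1 \<Psi> w w\<bar>} \<le>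
      measure ?G ({\<Psi> \<in> space ?G. (1 + t) * W \<le> X \<Psi>} \<union> {\<Psi> \<in> space ?G. X \<Psi> \<le> (1 - t) * W})"
    by (intro G.finite_measure_mono) measurable
  also have "\<dots> \<le> measure ?G {\<Psi> \<in> space ?G. (1 + t) * W \<le> X \<Psi>} + measure ?G {\<Psi> \<in> space ?G. X \<Psi> \<le> (1 - t) * W}"
    by (intro measure_Un_le) measurable
  finally show ?thesis using upper lower by (simp add: W_def)
qed

section \<open>The restricted isometry property of Gaussian matrices\<close>

lemma abs_le_power2_int: "\<bar>j :: int\<bar> \<le> j\<^sup>2"
proof (cases "j = 0")
  case False
  then have "\<bar>j\<bar> * 1 \<le> \<bar>j\<bar> * \<bar>j\<bar>" by (intro mult_left_mono) linarith+
  then show ?thesis by (simp only: abs_mult_self_eq mult_1_right power2_eq_square)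
qed simp

text \<open>Vectors scaled to norm \<open>4 * sqrt (3 s)\<close> move by at most
  \<open>sqrt (3 s)\<close> when rounded, so their squared norm ends up at most
  \<open>25 * 3 s = 75 s\<close>. The box exhibits the net as part of a finite product.\<close>

definition integer_net :: "nat \<Rightarrow> nat \<Rightarrow> (nat \<Rightarrow> int) set" where
  "integer_net n s = {z \<in> {..<n} \<rightarrow>\<^sub>E {- int (75 * s)..int (75 * s)}.
     card {i. i < n \<and> z i \<noteq> 0} \<le> 3 * s \<and> (\<Sum>i<n. (z i)\<^sup>2) \<le> int (75 * s)}"

lemma finite_integer_net: "finite (integer_net n s)"
  unfolding integer_net_def by (rule finite_subset[OF Collect_restrict]) (intro finite_PiE; simp)

text \<open>A nonzero entry pays \<open>q\<close> for its place in the support and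
  \<open>2^(-|j|)\<close> for its size. The total over any symmetric range is at most
  \<open>1 + 2 q\<close>.\<close>

definition net_weight :: "real \<Rightarrow> int \<Rightarrow> real" where
  "net_weight q j = (if j = 0 then 1 else q * (1 / 2) ^ nat \<bar>j\<bar>)"

lemma sum_net_weight: "(\<Sum>j = - int R..int R. net_weight q j) = 1 + q * (2 - 2 * (1 / 2) ^ R)"
proof (induction R)
  case 0
  show ?case by (simp add: net_weight_def)
next
  case (Suc R)
  have "{- int (Suc R)..int (Suc R)} = insert (int (Suc R)) (insert (- int (Suc R)) {- int R..int R})"
    by auto
  then have "(\<Sum>j = - int (Suc R)..int (Suc R). net_weight q j) =
      net_weight q (int (Suc R)) + (net_weight q (- int (Suc R)) + (\<Sum>j = - int R..int R. net_weight q j))"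
    by simp
  also have "\<dots> = 1 + q * (2 - 2 * (1 / 2) ^ Suc R)"
  proof -
    have "nat \<bar>int (Suc R)\<bar> = Suc R" "nat \<bar>- int (Suc R)\<bar> = Suc R" by linarith+
    then show ?thesis
      unfolding Suc.IH by (simp add: net_weight_def algebra_simps)
  qed
  finally show ?case .
qed

text \<open>For integers \<open>|j| \<le> j^2\<close>, so the bound on the sum of squares also
  bounds the sum of absolute values. Replacing \<open>1 / 2\<close> by the smaller
  \<open>exp (-1)\<close> keeps everything exponential.\<close>

lemma net_weight_lower:
  assumes z: "z \<in> integer_net n s" and q: "0 \<le> q" "q \<le> 1"
  shows "q ^ (3 * s) * exp (- real (75 * s)) \<le> (\<Prod>i<n. net_weight q (z i))"
proof -
  define S where "S = {i. i < n \<and> z i \<noteq> 0}"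
  have S: "finite S" "S \<subseteq> {..<n}" by (auto simp: S_def)
  have "int (\<Sum>i\<in>S. nat \<bar>z i\<bar>) = (\<Sum>i\<in>S. \<bar>z i\<bar>)" by simp
  also have "\<dots> \<le> (\<Sum>i\<in>S. (z i)\<^sup>2)"
    by (intro sum_mono abs_le_power2_int)
  also have "\<dots> \<le> (\<Sum>i<n. (z i)\<^sup>2)" using S by (intro sum_mono2) auto
  also have "\<dots> \<le> int (75 * s)" using z by (simp add: integer_net_def)
  finally have total: "(\<Sum>i\<in>S. nat \<bar>z i\<bar>) \<le> 75 * s" by linarith
  have card: "card S \<le> 3 * s" using z by (simp add: integer_net_def S_def)
  have "exp (-1) \<le> (1 / 2 :: real)"
    using exp_ge_add_one_self[of 1] by (simp add: exp_minus field_simps)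
  then have "exp (-1) ^ (75 * s) \<le> (1 / 2 :: real) ^ (75 * s)"
    by (intro power_mono) auto
  also have "\<dots> \<le> (1 / 2) ^ (\<Sum>i\<in>S. nat \<bar>z i\<bar>)"
    using total by (intro power_decreasing) auto
  finally have "exp (- real (75 * s)) \<le> (1 / 2) ^ (\<Sum>i\<in>S. nat \<bar>z i\<bar>)"
    by (simp flip: exp_of_nat_mult)
  then have "q ^ (3 * s) * exp (- real (75 * s)) \<le> q ^ card S * (1 / 2) ^ (\<Sum>i\<in>S. nat \<bar>z i\<bar>)"
    using q card by (intro mult_mono power_decreasing) auto
  also have "\<dots> = (\<Prod>i\<in>S. q * (1 / 2) ^ nat \<bar>z i\<bar>)"
    by (simp add: prod.distrib power_sum)
  also have "\<dots> = (\<Prod>i\<in>S. net_weight q (z i))"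
    by (intro prod.cong) (auto simp: net_weight_def S_def)
  also have "\<dots> = (\<Prod>i<n. net_weight q (z i))"
    using S by (intro prod.mono_neutral_left) (auto simp: net_weight_def S_def)
  finally show ?thesis .
qed

text \<open>
  Weighting a vector by a factor of order \<open>s / n\<close> for every nonzero entry counts the supports
  together with the entries.
\<close>

lemma card_integer_net:
  assumes "1 \<le> s" "s \<le> n"
  shows "real (card (integer_net n s)) \<le> exp (77 * real s + 3 * (real s * ln (real n / real s)))"
proof -
  \<comment> \<open>With this \<open>q\<close>, \<open>(1 + 2 q)^n\<close> is at most
    \<open>exp (2 s)\<close>, while \<open>q^(3 s)\<close> gives the term
    \<open>3 s ln (n / s)\<close>; \<open>77\<close> is \<open>75 + 2\<close>.\<close>
  define q where "q = real s / real n"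
  have q: "0 < q" "q \<le> 1" using assms by (auto simp: q_def)
  define L where "L = q ^ (3 * s) * exp (- real (75 * s))"
  let ?A = "{..<n} \<rightarrow>\<^sub>E {- int (75 * s)..int (75 * s)}"
  have "real (card (integer_net n s)) * L = (\<Sum>z\<in>integer_net n s. L)" by simp
  also have "\<dots> \<le> (\<Sum>z\<in>integer_net n s. \<Prod>i<n. net_weight q (z i))"
    unfolding L_def using q by (intro sum_mono net_weight_lower) auto
  also have "\<dots> \<le> (\<Sum>z\<in>?A. \<Prod>i<n. net_weight q (z i))"
  proof (rule sum_mono2)
    show "finite ?A" by (intro finite_PiE) simp_all
    show "integer_net n s \<subseteq> ?A" unfolding integer_net_def by (rule Collect_restrict)
    show "0 \<le> (\<Prod>i<n. net_weight q (z i))" for z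
      using q by (intro prod_nonneg) (simp add: net_weight_def)
  qed
  \<comment> \<open>Summing over the whole product set lets the sum factorise over
    coordinates.\<close>
  also have "\<dots> = (\<Prod>i<n. \<Sum>j = - int (75 * s)..int (75 * s). net_weight q j)"
    by (rule prod_sum_PiE[symmetric]) auto
  also have "\<dots> \<le> (exp (2 * q)) ^ n"
  proof -
    have "q * (2 - 2 * (1 / 2) ^ (75 * s)) \<le> q * 2"
      using q by (intro mult_left_mono) auto
    moreover have "0 \<le> q * (2 - 2 * (1 / 2) ^ (75 * s))"
      using q by (intro mult_nonneg_nonneg) (auto simp: power_le_one)
    ultimately show ?thesis
      unfolding sum_net_weight prod_constant card_lessThan
      using exp_ge_add_one_self[of "2 * q"] by (intro power_mono) linarith+
  qed
  also have "\<dots> = exp (2 * real s)"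
    using assms by (simp add: q_def flip: exp_of_nat_mult)
  finally have "real (card (integer_net n s)) * L \<le> exp (2 * real s)" .
  moreover have "L = exp (- (3 * (real s * ln (real n / real s))) - 75 * real s)"
  proof -
    have "q = exp (- ln (real n / real s))"
      using assms by (simp add: q_def ln_div exp_diff)
    then have "q ^ (3 * s) = exp (real (3 * s) * - ln (real n / real s))"
      by (simp only: exp_of_nat_mult)
    then show ?thesis
      by (simp add: L_def mult.assoc flip: exp_add)
  qed
  moreover have "exp (2 * real s) = exp (77 * real s + 3 * (real s * ln (real n / real s))) *
      exp (- (3 * (real s * ln (real n / real s))) - 75 * real s)"
    by (simp flip: exp_add)
  ultimately show ?thesis by simp
qed

text \<open>
  Every \<open>3 s\<close>-sparse \<open>w\<close> is within \<open>\<parallel>w\<parallel> / 4\<close> of a multiple of a point of the net, whose support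
  is contained in that of \<open>w\<close>. Comparing the quadratic forms at the two vectors shows that \<open>\<delta> \<le> 25 / 16 * t + 9 / 16 * \<delta>\<close>
  for the restricted isometry constant \<open>\<delta>\<close>.
\<close>

lemma restricted_isometry_constant_net:
  assumes s: "1 \<le> s" and t: "0 \<le> t"
    and net: "\<And>z. z \<in> integer_net n s \<Longrightarrow>
      \<bar>defect n k 1 \<Psi> (\<lambda>i. real_of_int (z i)) (\<lambda>i. real_of_int (z i))\<bar> \<le>
        t * (norm_Rn n (\<lambda>i. real_of_int (z i)))\<^sup>2"
  shows "restricted_isometry_constant k n (3 * s) \<Psi> \<le> 25 / 7 * t"
proof -
  define \<delta> where "\<delta> = restricted_isometry_constant k n (3 * s) \<Psi>"
  have \<delta>: "0 \<le> \<delta>" "restricted_isometry k n (3 * s) \<Psi> \<delta>"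
    unfolding \<delta>_def by (rule restricted_isometry_constant_nonneg restricted_isometry_constant_holds)+
  have "\<bar>defect n k 1 \<Psi> w w\<bar> \<le> (25 / 16 * t + 9 / 16 * \<delta>) * (norm_Rn n w)\<^sup>2"
    if w: "sparse_vec n (3 * s) w" for w
  proof (cases "norm_Rn n w = 0")
    case True
    then show ?thesis using \<delta>(2) w by (auto simp: restricted_isometry_iff_defect)
  next
    case False
    define N where "N = norm_Rn n w"
    have N: "N > 0" using False norm_Rn_nonneg[of n w] unfolding N_def by linarith
    \<comment> \<open>Scales \<open>w\<close> to norm \<open>4 * sqrt (3 s)\<close>, four times the
      largest possible rounding error on \<open>3 s\<close> entries.\<close>
    define c where "c = 4 * sqrt (real (3 * s)) / N"
    have c: "c > 0" using N s by (simp add: c_def)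
    define z where "z = (\<lambda>i\<in>{..<n}. \<lfloor>c * w i\<rfloor>)"
    define zr where "zr = (\<lambda>i. real_of_int (z i))"
    define u where "u = (\<lambda>i. (1 / c) * zr i)"
    define S where "S = {i. i < n \<and> w i \<noteq> 0}"
    have S: "finite S" "S \<subseteq> {..<n}" "card S \<le> 3 * s"
      using w by (auto simp: S_def sparse_vec_def)
    have z0: "z i = 0" if "i < n" "i \<notin> S" for i
      using that by (simp add: z_def S_def)
    have err: "norm_Rn n (\<lambda>i. w i - u i) \<le> N / 4"
    proof (rule power2_le_imp_le)
      have "(norm_Rn n (\<lambda>i. w i - u i))\<^sup>2 = (\<Sum>i\<in>S. (w i - u i)\<^sup>2)"
        unfolding norm_Rn_sq using S z0
        by (intro sum.mono_neutral_right) (auto simp: u_def zr_def S_def)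
      also have "\<dots> \<le> (\<Sum>i\<in>S. (1 / c)\<^sup>2)"
      proof (rule sum_mono)
        fix i assume "i \<in> S"
        then have "w i - u i = (c * w i - real_of_int \<lfloor>c * w i\<rfloor>) / c"
          using S c by (auto simp: u_def zr_def z_def field_simps)
        moreover have "0 \<le> (c * w i - real_of_int \<lfloor>c * w i\<rfloor>) / c"
          using c by (intro divide_nonneg_pos) linarith+
        moreover have "(c * w i - real_of_int \<lfloor>c * w i\<rfloor>) / c \<le> 1 / c"
          using c by (intro divide_right_mono) linarith+
        ultimately show "(w i - u i)\<^sup>2 \<le> (1 / c)\<^sup>2"
          by (intro power_mono) auto
      qed
      also have "\<dots> = real (card S) / c\<^sup>2" by (simp add: power_divide)
      also have "\<dots> \<le> real (3 * s) / c\<^sup>2"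
        using S(3) by (intro divide_right_mono) (auto simp del: of_nat_mult)
      also have "\<dots> = (N / 4)\<^sup>2"
        using s N by (simp add: c_def power_divide power_mult_distrib)
      finally show "(norm_Rn n (\<lambda>i. w i - u i))\<^sup>2 \<le> (N / 4)\<^sup>2" .
    qed (use N in simp)
    have u: "norm_Rn n u \<le> 5 / 4 * N"
      using norm_Rn_triangle[of n "\<lambda>i. (-1) * (w i - u i)" w] err
      unfolding norm_Rn_scale by (simp add: N_def)
    have zr: "zr = (\<lambda>i. c * u i)" using c by (simp add: u_def)
    have "norm_Rn n zr = c * norm_Rn n u" using c by (simp add: zr norm_Rn_scale)
    also have "\<dots> \<le> c * (5 / 4 * N)" using u c by (intro mult_left_mono) auto
    also have "\<dots> = 5 * sqrt (real (3 * s))" using N by (simp add: c_def)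
    finally have "(norm_Rn n zr)\<^sup>2 \<le> (5 * sqrt (real (3 * s)))\<^sup>2"
      by (intro power_mono) auto
    then have "real_of_int (\<Sum>i<n. (z i)\<^sup>2) \<le> real_of_int (int (75 * s))"
      by (simp add: norm_Rn_sq zr_def power_mult_distrib)
    then have total: "(\<Sum>i<n. (z i)\<^sup>2) \<le> int (75 * s)"
      by (simp only: of_int_le_iff)
    have "z \<in> integer_net n s"
      unfolding integer_net_def
    proof (intro CollectI conjI total)
      show "z \<in> {..<n} \<rightarrow>\<^sub>E {- int (75 * s)..int (75 * s)}"
      proof (rule PiE_I)
        fix i assume i: "i \<in> {..<n}"
        have "\<bar>z i\<bar> \<le> (z i)\<^sup>2" by (rule abs_le_power2_int)
        also have "\<dots> \<le> (\<Sum>i<n. (z i)\<^sup>2)" using i by (intro member_le_sum) auto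
        finally have "\<bar>z i\<bar> \<le> int (75 * s)" using total by linarith
        then show "z i \<in> {- int (75 * s)..int (75 * s)}" by auto
      qed (simp add: z_def)
      have "card {i. i < n \<and> z i \<noteq> 0} \<le> card S"
        using z0 S by (intro card_mono) auto
      with S show "card {i. i < n \<and> z i \<noteq> 0} \<le> 3 * s" by linarith
    qed
    then have "\<bar>defect n k 1 \<Psi> zr zr\<bar> \<le> t * (norm_Rn n zr)\<^sup>2"
      unfolding zr_def by (rule net)
    then have "c\<^sup>2 * \<bar>defect n k 1 \<Psi> u u\<bar> \<le> c\<^sup>2 * (t * (norm_Rn n u)\<^sup>2)"
      unfolding zr defect_scale norm_Rn_scale by (simp add: abs_mult power_mult_distrib mult_ac)
    then have "\<bar>defect n k 1 \<Psi> u u\<bar> \<le> t * (norm_Rn n u)\<^sup>2" using c by simp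
    also have "\<dots> \<le> t * (5 / 4 * N)\<^sup>2" using u t by (intro mult_left_mono power_mono) auto
    finally have qu: "\<bar>defect n k 1 \<Psi> u u\<bar> \<le> 25 / 16 * t * N\<^sup>2"
      by (simp add: power_mult_distrib power_divide)
    have "\<bar>defect n k 1 \<Psi> (\<lambda>i. w i + u i) (\<lambda>i. w i - u i)\<bar> \<le>
        \<delta> * norm_Rn n (\<lambda>i. w i + u i) * norm_Rn n (\<lambda>i. w i - u i)"
    proof (rule abs_defect_le)
      show "\<bar>defect n k 1 \<Psi> v v\<bar> \<le> \<delta> * (norm_Rn n v)\<^sup>2" if "\<And>i. i < n \<Longrightarrow> i \<notin> S \<Longrightarrow> v i = 0" for v
        using \<delta>(2) sparse_vec_zeros[OF w, of v] that
        unfolding restricted_isometry_iff_defect S_def by blast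
    qed (use z0 in \<open>auto simp: S_def u_def zr_def\<close>)
    also have "\<dots> \<le> \<delta> * (9 / 4 * N) * (N / 4)"
      using \<delta>(1) err u norm_Rn_triangle[of n w u] N by (intro mult_mono) (auto simp: N_def)
    finally have cross: "\<bar>defect n k 1 \<Psi> (\<lambda>i. w i + u i) (\<lambda>i. w i - u i)\<bar> \<le> 9 / 16 * \<delta> * N\<^sup>2"
      by (simp add: power2_eq_square)
    \<comment> \<open>The difference of squares for a symmetric form. The factors
      \<open>w + u\<close> and \<open>w - u\<close> have norms at most \<open>9 / 4 * N\<close> and
      \<open>N / 4\<close>, hence \<open>9 / 16\<close>.\<close>
    have "defect n k 1 \<Psi> w w = defect n k 1 \<Psi> u u + defect n k 1 \<Psi> (\<lambda>i. w i + u i) (\<lambda>i. w i - u i)"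
      unfolding defect_def mat_vec_diff
      by (simp add: inner_Rn_def mat_vec_def algebra_simps sum.distrib sum_subtractf)
    then show ?thesis
      using qu cross unfolding N_def[symmetric] distrib_right by linarith
  qed
  then have "restricted_isometry k n (3 * s) \<Psi> (25 / 16 * t + 9 / 16 * \<delta>)"
    by (simp add: restricted_isometry_iff_defect)
  \<comment> \<open>Minimality of \<open>\<delta>\<close> turns the new admissible constant into an
    inequality for \<open>\<delta>\<close> itself, which is then solved.\<close>
  then have "\<delta> \<le> 25 / 16 * t + 9 / 16 * \<delta>"
    unfolding \<delta>_def using t restricted_isometry_constant_nonneg[of k n "3 * s" \<Psi>]
    by (simp add: restricted_isometry_constant_le_iff)
  then show ?thesis unfolding \<delta>_def by simp
qed

text \<open>For \<open>n \<ge> 2 s\<close> the logarithm is at least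
  \<open>ln 2 \<ge> 1 / 2\<close>; otherwise the second clause of the regime applies. The bound lets
  \<open>k\<close> absorb the terms linear in \<open>s\<close>, both in the union bound and in the
  cost of thresholding.\<close>

lemma enough_measurements_sparsity:
  assumes "0 < K" "1 \<le> s" "enough_measurements K n s k"
  shows "real s \<le> 2 * real k / K"
proof (cases "n < 2 * s")
  case True
  then have "K * real s \<le> real k" using assms by (simp add: enough_measurements_def)
  then have "K * real s \<le> 2 * real k" by linarith
  then show ?thesis using assms(1) by (simp add: field_simps)
next
  case False
  then have "2 * real s \<le> real n" by linarith
  then have "ln 2 \<le> ln (real n / real s)"
    using assms(2) by (intro ln_mono) (auto simp: field_simps)
  then have "1 / 2 \<le> ln (real n / real s)"
    using ln_one_minus_pos_upper_bound[of "1/2"] by (simp add: ln_div)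
  then have "K * real s * (1 / 2) \<le> K * real s * ln (real n / real s)"
    using assms(1) by (intro mult_left_mono) auto
  also have "\<dots> \<le> real k" using assms by (simp add: enough_measurements_def)
  finally show ?thesis using assms(1) by (simp add: field_simps)
qed

lemma enough_measurements_pos:
  assumes "0 < K" "1 \<le> s" "enough_measurements K n s k"
  shows "0 < k"
  using enough_measurements_sparsity[OF assms] assms by (cases k) auto

text \<open>Union bound: if the constant exceeds \<open>25 / 7 * t\<close>, some point of the net
  has a \<open>defect\<close> that is too large.\<close>

lemma prob_restricted_isometry_constant:
  assumes "0 < k" "1 \<le> s" "s \<le> n" and t: "0 < t" "t \<le> 1"
  shows "measure (gaussian_matrix k n)
      {\<Psi> \<in> space (gaussian_matrix k n). restricted_isometry_constant k n (3 * s) \<Psi> \<le> 25 / 7 * t} \<ge>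
    1 - 2 * exp (77 * real s + 3 * (real s * ln (real n / real s)) - real k * t\<^sup>2 / 16)"
proof -
  let ?G = "gaussian_matrix k n"
  interpret G: prob_space ?G
    by (rule prob_space_gaussian_matrix[OF assms(1)])
  define bad where "bad z = {\<Psi> \<in> space ?G. t * (norm_Rn n (\<lambda>i. real_of_int (z i)))\<^sup>2 <
      \<bar>defect n k 1 \<Psi> (\<lambda>i. real_of_int (z i)) (\<lambda>i. real_of_int (z i))\<bar>}" for z :: "nat \<Rightarrow> int"
  let ?good = "{\<Psi> \<in> space ?G. restricted_isometry_constant k n (3 * s) \<Psi> \<le> 25 / 7 * t}"
  have [measurable]: "bad z \<in> sets ?G" for z
    unfolding bad_def using measurable_defect[measurable] by measurable
  have good [measurable]: "?good \<in> sets ?G"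
    using measurable_restricted_isometry_constant[measurable] by measurable
  \<comment> \<open>The concentration bound is for nonzero vectors; at the zero vector
    \<open>bad\<close> is empty because its inequality is strict.\<close>
  have bad_le: "measure ?G (bad z) \<le> 2 * exp (- real k * t\<^sup>2 / 16)" for z
  proof (cases "norm_Rn n (\<lambda>i. real_of_int (z i)) = 0")
    case True
    then have "defect n k 1 \<Psi> (\<lambda>i. real_of_int (z i)) (\<lambda>i. real_of_int (z i)) = 0" for \<Psi>
      by (simp add: norm_Rn_eq_0_iff defect_def inner_Rn_def mat_vec_def)
    with True have "bad z = {}" by (simp add: bad_def)
    then show ?thesis by simp
  next
    case False
    then show ?thesis unfolding bad_def by (intro gaussian_concentration assms) auto
  qed
  have "space ?G - ?good \<subseteq> (\<Union>z\<in>integer_net n s. bad z)"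
  proof
    fix \<Psi> assume \<Psi>: "\<Psi> \<in> space ?G - ?good"
    show "\<Psi> \<in> (\<Union>z\<in>integer_net n s. bad z)"
    proof (rule ccontr)
      assume "\<Psi> \<notin> (\<Union>z\<in>integer_net n s. bad z)"
      then have "restricted_isometry_constant k n (3 * s) \<Psi> \<le> 25 / 7 * t"
        using \<Psi> t assms by (intro restricted_isometry_constant_net) (auto simp: bad_def not_less)
      with \<Psi> show False by auto
    qed
  qed
  then have "measure ?G (space ?G - ?good) \<le> measure ?G (\<Union>z\<in>integer_net n s. bad z)"
    by (intro G.finite_measure_mono sets.finite_UN finite_integer_net) auto
  also have "\<dots> \<le> (\<Sum>z\<in>integer_net n s. measure ?G (bad z))"
    by (intro G.finite_measure_subadditive_finite finite_integer_net) auto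
  also have "\<dots> \<le> (\<Sum>z\<in>integer_net n s. 2 * exp (- real k * t\<^sup>2 / 16))"
    by (intro sum_mono bad_le)
  also have "\<dots> = real (card (integer_net n s)) * (2 * exp (- real k * t\<^sup>2 / 16))" by simp
  also have "\<dots> \<le> exp (77 * real s + 3 * (real s * ln (real n / real s))) * (2 * exp (- real k * t\<^sup>2 / 16))"
    by (intro mult_right_mono card_integer_net assms) simp
  also have "\<dots> = 2 * exp (77 * real s + 3 * (real s * ln (real n / real s)) - real k * t\<^sup>2 / 16)"
    by (simp add: mult.left_commute[of _ 2] flip: exp_add)
  finally show ?thesis using G.prob_compl[OF good] by linarith
qed

text \<open>
  With \<open>t = 1 / 60\<close> half of the exponent \<open>t\<^sup>2 / 16 = 1 / 57600\<close> pays for the union bound, whose logarithm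
  is at most \<open>(77 * 2 + 3) * k / K\<close>.
\<close>

lemma gaussian_rip_constants_exist: "gaussian_rip_constants 2 (1 / 115200) (157 * 115200)"
  unfolding gaussian_rip_constants_def
proof (intro conjI allI impI)
  fix n s k :: nat
  assume a: "1 \<le> s \<and> s \<le> n \<and> enough_measurements (157 * 115200) n s k"
  let ?G = "gaussian_matrix k n"
  let ?E = "\<lambda>\<delta>. {\<Psi> \<in> space ?G. restricted_isometry_constant k n (3 * s) \<Psi> \<le> \<delta>}"
  have k: "0 < k" using a enough_measurements_pos[of "157 * 115200" s n k] by simp
  interpret G: prob_space ?G by (rule prob_space_gaussian_matrix[OF k])
  have "real s \<le> 2 * real k / (157 * 115200)"
    using a by (intro enough_measurements_sparsity) auto
  moreover have "157 * 115200 * (real s * ln (real n / real s)) \<le> real k"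
    using a by (simp add: enough_measurements_def mult.assoc)
  ultimately have "77 * real s + 3 * (real s * ln (real n / real s)) - real k * (1 / 60)\<^sup>2 / 16 \<le>
      - (1 / 115200) * real k"
    by (simp add: power2_eq_square)
  then have "1 - 2 * exp (- (1 / 115200) * real k) \<le>
      1 - 2 * exp (77 * real s + 3 * (real s * ln (real n / real s)) - real k * (1 / 60)\<^sup>2 / 16)"
    by simp
  also have "\<dots> \<le> measure ?G (?E (25 / 7 * (1 / 60)))"
    using a k by (intro prob_restricted_isometry_constant) auto
  \<comment> \<open>\<open>25 / 7 * (1 / 60) = 5 / 84\<close> lies just below
    \<open>1 / 15\<close>.\<close>
  also have "\<dots> \<le> measure ?G (?E (1 / 15))"
    using measurable_restricted_isometry_constant[measurable]
    by (intro G.finite_measure_mono) (auto, measurable)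
  finally show "1 - 2 * exp (- (1 / 115200) * real k) \<le> measure ?G (?E (1 / 15))" .
qed simp_all

section \<open>Refresh and cost\<close>

text \<open>Thresholding is discontinuous, but ranks count measurable comparisons, so the choice of
  the kept entries is measurable.\<close>

lemma measurable_hard_threshold:
  assumes "i < n" and v: "\<And>j. j < n \<Longrightarrow> (\<lambda>\<omega>. v \<omega> j) \<in> borel_measurable M"
  shows "(\<lambda>\<omega>. hard_threshold n s (v \<omega>) i) \<in> borel_measurable M"
proof -
  have pred: "Measurable.pred M (\<lambda>\<omega>. j < n \<and> precedes (v \<omega>) j i)" for j
  proof (cases "j < n")
    case True
    note [measurable] = v[OF True] v[OF assms(1)]
    show ?thesis unfolding precedes_def by measurable
  qed simp
  have "(\<lambda>\<omega>. magnitude_rank n (v \<omega>) i) \<in> M \<rightarrow>\<^sub>M count_space UNIV"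
    unfolding magnitude_rank_def
    by (rule measurable_card, unfold mem_Collect_eq, rule pred[unfolded pred_def])
  then have [measurable]: "Measurable.pred M (\<lambda>\<omega>. magnitude_rank n (v \<omega>) i < s)"
    by (rule measurable_compose) simp
  note [measurable] = v[OF assms(1)]
  show ?thesis
    unfolding hard_threshold_altdef largest_entries_def mem_Collect_eq by measurable
qed

lemma measurable_iht:
  assumes f: "differentiable_Rn n f" and "i < n"
  shows "(\<lambda>\<Psi>. fst (iht M \<xi> k n s T f x \<Psi>) i) \<in> borel_measurable (gaussian_matrix k n)"
proof -
  define \<mu> where "\<mu> \<Psi> = 1 / (1 + restricted_isometry_constant k n s \<Psi>)" for \<Psi>
  define z where "z \<Psi> = fst (measurements \<xi> f x \<Psi> k)" for \<Psi>
  have \<mu>: "\<mu> \<in> borel_measurable (gaussian_matrix k n)"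
    unfolding \<mu>_def using measurable_restricted_isometry_constant[measurable] by measurable
  have z: "(\<lambda>\<Psi>. z \<Psi> i) \<in> borel_measurable (gaussian_matrix k n)" if "i < k" for i
    unfolding z_def fst_measurements[OF f that] by (rule measurable_mat_vec[OF that]) simp
  have "(\<lambda>\<Psi>. (iht_map k n s \<Psi> (\<mu> \<Psi>) (z \<Psi>) ^^ T) (\<lambda>_. 0) i) \<in> borel_measurable (gaussian_matrix k n)"
    using \<open>i < n\<close>
  \<comment> \<open>Each coordinate of an iterate depends on all coordinates of the previous
    one.\<close>
  proof (induction T arbitrary: i)
    case (Suc T)
    define y where "y \<Psi> = (iht_map k n s \<Psi> (\<mu> \<Psi>) (z \<Psi>) ^^ T) (\<lambda>_. 0)" for \<Psi>
    have y: "(\<lambda>\<Psi>. y \<Psi> j) \<in> borel_measurable (gaussian_matrix k n)" if "j < n" for j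
      unfolding y_def by (rule Suc.IH[OF that])
    show ?case
      unfolding funpow.simps comp_def y_def[symmetric] unfolding iht_map_def
      by (intro measurable_hard_threshold borel_measurable_add borel_measurable_times
          measurable_tmat_vec borel_measurable_diff measurable_mat_vec z \<mu> y Suc.prems)
  qed simp
  then show ?thesis by (simp add: fst_iht \<mu>_def z_def)
qed

text \<open>A normalised vector has norm \<open>1\<close> or, for the zero vector, \<open>0\<close>.
  This constant bound makes the squared alignment integrable.\<close>

lemma inner_normalize_sq_le: "(inner_Rn n (normalize_Rn n v) g)\<^sup>2 \<le> (norm_Rn n g)\<^sup>2"
proof -
  have "normalize_Rn n v = (\<lambda>i. (1 / norm_Rn n v) * v i)" by (simp add: normalize_Rn_def)
  then have "norm_Rn n (normalize_Rn n v) \<le> 1"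
    by (simp only: norm_Rn_scale) simp
  then have "norm_Rn n (normalize_Rn n v) * norm_Rn n g \<le> 1 * norm_Rn n g"
    by (intro mult_right_mono) auto
  then have "\<bar>inner_Rn n (normalize_Rn n v) g\<bar> \<le> norm_Rn n g"
    using abs_inner_Rn_le[of n "normalize_Rn n v" g] by linarith
  then show ?thesis using power_mono[of "\<bar>inner_Rn n (normalize_Rn n v) g\<bar>" "norm_Rn n g" 2] by simp
qed

lemma norm_Rn_diff_sq:
  "(norm_Rn n (\<lambda>i. v i - g i))\<^sup>2 = (norm_Rn n v)\<^sup>2 - 2 * inner_Rn n v g + (norm_Rn n g)\<^sup>2"
  unfolding norm_Rn_sq inner_Rn_def sum_distrib_left sum_subtractf[symmetric] sum.distrib[symmetric]
  by (intro sum.cong refl) (simp add: power2_eq_square algebra_simps)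

text \<open>
  For \<open>a = \<parallel>v\<parallel>\<close> and \<open>b = \<parallel>g\<parallel>\<close> the assumption says \<open>2 \<langle>v, g\<rangle> \<ge> a\<^sup>2 + (1 - \<rho>\<^sup>2) b\<^sup>2\<close>, and by AM-GM the right-hand
  side is at least \<open>2 a b sqrt (1 - \<rho>\<^sup>2)\<close>.
\<close>

lemma alignment_of_recovery:
  assumes "norm_Rn n (\<lambda>i. v i - g i) \<le> \<rho> * norm_Rn n g" "0 \<le> \<rho>" "\<rho> < 1"
  shows "(1 - \<rho>\<^sup>2) * (norm_Rn n g)\<^sup>2 \<le> (inner_Rn n (normalize_Rn n v) g)\<^sup>2"
proof (cases "norm_Rn n g = 0")
  case False
  define a where "a = norm_Rn n v"
  define b where "b = norm_Rn n g"
  define r where "r = sqrt (1 - \<rho>\<^sup>2)"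
  have r: "r\<^sup>2 = 1 - \<rho>\<^sup>2" "0 \<le> r"
    using assms(2,3) by (simp_all add: r_def power_le_one)
  have b: "b > 0" using False norm_Rn_nonneg[of n g] unfolding b_def by linarith
  have "(norm_Rn n (\<lambda>i. v i - g i))\<^sup>2 \<le> (\<rho> * b)\<^sup>2"
    unfolding b_def using assms(1) by (intro power_mono) auto
  then have i: "a\<^sup>2 + r\<^sup>2 * b\<^sup>2 \<le> 2 * inner_Rn n v g"
    unfolding norm_Rn_diff_sq r(1) by (simp add: a_def b_def power_mult_distrib algebra_simps)
  \<comment> \<open>For \<open>v = 0\<close> the error would be the whole norm of \<open>g\<close>,
    against \<open>\<rho> < 1\<close>.\<close>
  have a: "a > 0"
  proof (rule ccontr)
    assume "\<not> a > 0"
    then have "norm_Rn n v = 0" using norm_Rn_nonneg[of n v] unfolding a_def by linarith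
    then have "norm_Rn n (\<lambda>i. v i - g i) = norm_Rn n (\<lambda>i. (-1) * g i)"
      by (intro norm_Rn_cong) (simp add: norm_Rn_eq_0_iff)
    then have "1 * b \<le> \<rho> * b" using assms(1) unfolding norm_Rn_scale by (simp add: b_def)
    then show False using assms(3) b by simp
  qed
  have "0 \<le> (a - r * b)\<^sup>2" by simp
  then have "2 * (r * b * a) \<le> a\<^sup>2 + r\<^sup>2 * b\<^sup>2"
    by (simp add: power2_diff power_mult_distrib mult_ac)
  with i have "r * b \<le> inner_Rn n v g / a"
    using a by (simp add: pos_le_divide_eq)
  moreover have "inner_Rn n (normalize_Rn n v) g = inner_Rn n v g / a"
    by (simp add: inner_Rn_def normalize_Rn_def a_def sum_divide_distrib)
  ultimately have "(r * b)\<^sup>2 \<le> (inner_Rn n (normalize_Rn n v) g)\<^sup>2"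
    using r b by (intro power_mono) auto
  then show ?thesis by (simp add: power_mult_distrib r(1) b_def)
qed simp

lemma half_power_iht_iterations:
  assumes "0 < \<rho>"
  shows "1 / 2 ^ iht_iterations \<rho> \<le> \<rho>"
proof -
  define T where "T = iht_iterations \<rho>"
  have "ln (1 / \<rho>) / ln 2 \<le> real T"
    unfolding T_def iht_iterations_def by linarith
  then have "ln (1 / \<rho>) \<le> real T * ln 2" by (simp add: pos_divide_le_eq)
  also have "\<dots> = ln (2 ^ T)" by (simp add: ln_realpow)
  finally have "1 / \<rho> \<le> 2 ^ T" using assms by (subst (asm) ln_le_cancel_iff) auto
  then show ?thesis using assms by (simp add: T_def field_simps)
qed

text \<open>On the restricted isometry event the squared alignment is at least
  \<open>\<gamma> / p\<close> of the squared gradient norm, elsewhere it is nonnegative; the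
  probability \<open>p\<close> cancels the denominator.\<close>

lemma iht_is_refresh:
  assumes "s \<le> n" "0 < k" and f: "sparse_fun n s f" "differentiable_Rn n f"
    and p: "measure (gaussian_matrix k n)
      {\<Psi> \<in> space (gaussian_matrix k n). restricted_isometry_constant k n (3 * s) \<Psi> \<le> 1 / 15} \<ge> p"
    and \<gamma>: "0 < \<gamma>" "\<gamma> < p"
  shows "is_refresh (gaussian_matrix k n) n f x
    (\<lambda>\<Psi>. fst (iht M \<xi> k n s (iht_iterations (recovery_error p \<gamma>)) f x \<Psi>)) \<gamma>"
proof -
  let ?G = "gaussian_matrix k n"
  interpret G: prob_space ?G
    by (rule prob_space_gaussian_matrix[OF assms(2)])
  define \<rho> where "\<rho> = recovery_error p \<gamma>"
  define v where "v \<Psi> = fst (iht M \<xi> k n s (iht_iterations \<rho>) f x \<Psi>)" for \<Psi>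
  define g where "g = grad f x"
  define h where "h \<Psi> = (inner_Rn n (normalize_Rn n (v \<Psi>)) g)\<^sup>2" for \<Psi>
  define E where "E = {\<Psi> \<in> space ?G. restricted_isometry_constant k n (3 * s) \<Psi> \<le> 1 / 15}"
  have ratio: "0 < \<gamma> / p" "\<gamma> / p < 1" using \<gamma> by auto
  have \<rho>: "0 < \<rho>" "\<rho> < 1" "1 - \<rho>\<^sup>2 = \<gamma> / p"
    using ratio by (auto simp: \<rho>_def recovery_error_def)
  have v: "(\<lambda>\<Psi>. v \<Psi> i) \<in> borel_measurable ?G" if "i < n" for i
    unfolding v_def by (rule measurable_iht[OF f(2) that])
  have norm_v: "(\<lambda>\<Psi>. norm_Rn n (v \<Psi>)) \<in> borel_measurable ?G"
    unfolding norm_Rn_def L2_set_def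
    by (intro borel_measurable_sqrt[THEN measurable_compose[rotated]] borel_measurable_sum
        borel_measurable_power v) simp
  have h: "h \<in> borel_measurable ?G"
    unfolding h_def inner_Rn_def normalize_Rn_def
    by (intro borel_measurable_power borel_measurable_sum borel_measurable_times
        borel_measurable_divide v norm_v borel_measurable_const) simp
  have E [measurable]: "E \<in> sets ?G"
    unfolding E_def using measurable_restricted_isometry_constant[measurable] by measurable
  have int_h: "integrable ?G h"
    by (rule G.integrable_const_bound[where B = "(norm_Rn n g)\<^sup>2"])
      (use h in \<open>auto simp: h_def inner_normalize_sq_le\<close>)
  obtain S where S: "S \<subseteq> {..<n}" "card S = s" "\<forall>x y. (\<forall>i\<in>S. x i = y i) \<longrightarrow> f x = f y"
    using f(1) by (auto simp: sparse_fun_def)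
  have aligned: "\<gamma> / p * (norm_Rn n g)\<^sup>2 \<le> h \<Psi>" if "\<Psi> \<in> E" for \<Psi>
  proof -
    have "norm_Rn n (\<lambda>i. v \<Psi> i - g i) \<le> norm_Rn n g / 2 ^ iht_iterations \<rho>"
      unfolding v_def fst_iht
    proof (rule iht_recovery[OF \<open>s \<le> n\<close> _ S(1)])
      show "restricted_isometry_constant k n (3 * s) \<Psi> \<le> 1 / 15" using that by (simp add: E_def)
      show "g i = 0" if "i \<notin> S" for i
        unfolding g_def by (rule grad_sparse[OF S(3) that])
      show "fst (measurements \<xi> f x \<Psi> k) i = mat_vec n \<Psi> g i" if "i < k" for i
        unfolding g_def by (rule fst_measurements[OF f(2) that])
    qed (simp add: S(2))
    also have "\<dots> = (1 / 2 ^ iht_iterations \<rho>) * norm_Rn n g" by simp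
    also have "\<dots> \<le> \<rho> * norm_Rn n g"
      by (intro mult_right_mono half_power_iht_iterations \<rho>) simp
    finally show ?thesis
      using alignment_of_recovery[of n "v \<Psi>" g \<rho>] \<rho> by (simp add: h_def)
  qed
  have "\<gamma> * (norm_Rn n g)\<^sup>2 = p * (\<gamma> / p * (norm_Rn n g)\<^sup>2)" using \<gamma> by simp
  also have "\<dots> \<le> measure ?G E * (\<gamma> / p * (norm_Rn n g)\<^sup>2)"
    using p ratio unfolding E_def by (intro mult_right_mono mult_nonneg_nonneg) auto
  also have "\<dots> = (\<integral>\<Psi>. indicator E \<Psi> * (\<gamma> / p * (norm_Rn n g)\<^sup>2) \<partial>?G)"
    by (simp add: E)
  also have "\<dots> \<le> (\<integral>\<Psi>. h \<Psi> \<partial>?G)"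
  proof (rule integral_mono[OF _ int_h])
    show "integrable ?G (\<lambda>\<Psi>. indicator E \<Psi> * (\<gamma> / p * (norm_Rn n g)\<^sup>2))"
      by (intro integrable_mult_left) (simp add: E G.emeasure_eq_measure)
    show "indicator E \<Psi> * (\<gamma> / p * (norm_Rn n g)\<^sup>2) \<le> h \<Psi>" for \<Psi>
      using aligned[of \<Psi>] by (cases "\<Psi> \<in> E") (auto simp: h_def)
  qed
  finally show ?thesis
    using v unfolding is_refresh_def v_def h_def g_def \<rho>_def by simp
qed

text \<open>Dividing half the logarithm by \<open>ln 2 \<ge> 1 / 2\<close> leaves at most the whole
  of it, and rounding up adds at most \<open>1\<close>. The lower bound uses
  \<open>\<gamma> / p \<ge> \<eta>\<close>.\<close>

lemma iht_iterations_le: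
  assumes "0 < \<eta>" "\<eta> < 1" "\<eta> \<le> \<gamma>" "\<gamma> < p" "p \<le> 1"
  shows "- ln (1 - \<eta>) \<le> ln (p / (p - \<gamma>))"
    and "real (iht_iterations (recovery_error p \<gamma>)) \<le> ln (p / (p - \<gamma>)) + 1"
proof -
  have q: "\<eta> \<le> \<gamma> / p" "\<gamma> / p < 1"
  proof -
    have "\<eta> * p \<le> \<gamma> * 1" using assms by (intro mult_mono) auto
    then show "\<eta> \<le> \<gamma> / p" using assms by (simp add: field_simps)
  qed (use assms in auto)
  have "p / (p - \<gamma>) = 1 / (1 - \<gamma> / p)" using assms by (simp add: field_simps)
  then have L: "ln (p / (p - \<gamma>)) = - ln (1 - \<gamma> / p)" using q by (simp add: ln_div)
  show "- ln (1 - \<eta>) \<le> ln (p / (p - \<gamma>))"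
    unfolding L using q assms by simp
  then have pos: "0 \<le> ln (p / (p - \<gamma>))"
    using assms by (smt (verit) ln_le_zero_iff)
  have half: "1 / 2 \<le> ln (2 :: real)"
    using ln_one_minus_pos_upper_bound[of "1/2"] by (simp add: ln_div)
  have "ln (1 / recovery_error p \<gamma>) = ln (p / (p - \<gamma>)) / 2"
    unfolding L recovery_error_def using q by (simp add: ln_div ln_sqrt)
  also have "\<dots> \<le> ln (p / (p - \<gamma>)) * ln 2"
    using mult_left_mono[OF half pos] by simp
  finally have "ln (1 / recovery_error p \<gamma>) / ln 2 \<le> ln (p / (p - \<gamma>))"
    by (simp add: pos_divide_le_eq)
  then show "real (iht_iterations (recovery_error p \<gamma>)) \<le> ln (p / (p - \<gamma>)) + 1"
    unfolding iht_iterations_def using pos by linarith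
qed

text \<open>The summands of the constant pay for sampling, the iterations and the directional
  derivatives. In one iteration, \<open>5\<close> counts two matrix products and three vector
  operations, and \<open>D\<close> pays for thresholding. The quotient
  \<open>L / L\<^sub>0 \<ge> 1\<close> absorbs additive constants.\<close>

lemma iht_cost_le:
  assumes B: "0 < B" "costs_bounded B M" and pos: "0 < k" "0 < s" "s \<le> n"
    and s: "real s \<le> D * real k" and L: "0 < L\<^sub>0" "L\<^sub>0 \<le> L" and T: "real T \<le> L + 1" and \<xi>: "0 \<le> \<xi>"
  shows "snd (iht M \<xi> k n s T f x \<Psi>) \<le>
    (B / L\<^sub>0 + (1 + 1 / L\<^sub>0) * (B * (5 + D)) + 1) * (L * real k * real n + real k * \<xi>)"
proof -
  define m where "m = real k * real n"
  have n: "0 < n" using pos by simp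
  have m: "0 \<le> m" "real k \<le> m" "real n \<le> m"
    using pos n by (auto simp: m_def)
  have D: "0 \<le> D"
  proof (rule ccontr)
    assume "\<not> 0 \<le> D"
    then have "D * real k < 0" using pos by (simp add: mult_neg_pos)
    with s show False by linarith
  qed
  have M: "matvec_cost M k n \<le> B * m" "vecop_cost M k \<le> B * real k" "vecop_cost M n \<le> B * real n"
    "threshold_cost M n s \<le> B * real s * real n" "sample_cost M \<le> B"
    using B(2) pos n by (auto simp: costs_bounded_def m_def mult.assoc)
  have "B * real k \<le> B * m" "B * real n \<le> B * m"
    using B m by auto
  moreover have "B * real s * real n \<le> B * (D * m)"
  proof -
    have "B * real s * real n \<le> B * (D * real k) * real n"
      using B s by (intro mult_right_mono mult_left_mono) auto
    then show ?thesis by (simp add: m_def mult_ac)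
  qed
  ultimately have "2 * matvec_cost M k n + vecop_cost M k + 2 * vecop_cost M n + threshold_cost M n s
      \<le> 5 * (B * m) + B * (D * m)"
    using M by linarith
  also have "\<dots> = B * (5 + D) * m" by (simp add: algebra_simps)
  finally have "real T * (2 * matvec_cost M k n + vecop_cost M k + 2 * vecop_cost M n + threshold_cost M n s)
      \<le> real T * (B * (5 + D) * m)"
    by (intro mult_left_mono) auto
  also have "\<dots> \<le> ((1 + 1 / L\<^sub>0) * L) * (B * (5 + D) * m)"
  proof (rule mult_right_mono)
    have "1 \<le> L / L\<^sub>0" using L by simp
    then show "real T \<le> (1 + 1 / L\<^sub>0) * L" using T by (simp add: algebra_simps)
    show "0 \<le> B * (5 + D) * m" using B D m by simp
  qed
  finally have steps: "real T * (2 * matvec_cost M k n + vecop_cost M k + 2 * vecop_cost M n + threshold_cost M n s)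
      \<le> (1 + 1 / L\<^sub>0) * (B * (5 + D)) * (L * m)"
    by (simp add: mult_ac)
  have "m * sample_cost M \<le> m * B" using M m by (intro mult_left_mono) auto
  also have "\<dots> \<le> (m * B) * (L / L\<^sub>0)"
    using mult_left_mono[of 1 "L / L\<^sub>0" "m * B"] L B m by simp
  finally have sample: "m * sample_cost M \<le> B / L\<^sub>0 * (L * m)" by (simp add: mult_ac)
  define c\<^sub>1 where "c\<^sub>1 = B / L\<^sub>0"
  define c\<^sub>2 where "c\<^sub>2 = (1 + 1 / L\<^sub>0) * (B * (5 + D))"
  have "0 \<le> (c\<^sub>1 + c\<^sub>2) * (real k * \<xi>)"
    unfolding c\<^sub>1_def c\<^sub>2_def using B D L \<xi> by (intro mult_nonneg_nonneg add_nonneg_nonneg) auto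
  moreover have "0 \<le> L * m" using L m by simp
  moreover have "snd (iht M \<xi> k n s T f x \<Psi>) \<le> c\<^sub>1 * (L * m) + real k * \<xi> + c\<^sub>2 * (L * m)"
    unfolding snd_iht m_def[symmetric] c\<^sub>1_def c\<^sub>2_def using steps sample by linarith
  moreover have "(c\<^sub>1 + c\<^sub>2 + 1) * (L * m + real k * \<xi>) =
      c\<^sub>1 * (L * m) + c\<^sub>2 * (L * m) + L * m + (c\<^sub>1 + c\<^sub>2) * (real k * \<xi>) + real k * \<xi>"
    by (simp add: algebra_simps)
  ultimately have "snd (iht M \<xi> k n s T f x \<Psi>) \<le> (c\<^sub>1 + c\<^sub>2 + 1) * (L * m + real k * \<xi>)"
    by linarith
  then show ?thesis by (simp add: c\<^sub>1_def c\<^sub>2_def m_def mult.assoc)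
qed

theorem proposition2:
  shows "(\<exists>C c K. gaussian_rip_constants C c K) \<and>
    (\<forall>C c K. gaussian_rip_constants C c K \<longrightarrow>
      (\<forall>B>0. \<forall>\<eta>>0. \<exists>A>0.
        \<forall>(n::nat) (s::nat) (k::nat) (f :: rvec \<Rightarrow> real) (x :: rvec) (\<xi>::real) (\<gamma>\<^sub>0::real) (M::cost_model).
          1 \<le> s \<and> s \<le> n \<and> enough_measurements K n s k \<and>
          sparse_fun n s f \<and> differentiable_Rn n f \<and>
          0 \<le> \<xi> \<and> costs_bounded B M \<and>
          \<eta> \<le> \<gamma>\<^sub>0 \<and> \<gamma>\<^sub>0 < 1 \<and> \<gamma>\<^sub>0 < 1 - C * exp (- c * real k) \<longrightarrow>
          (let p = 1 - C * exp (- c * real k);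
               T = iht_iterations (recovery_error p \<gamma>\<^sub>0)
           in is_refresh (gaussian_matrix k n) n f x (\<lambda>\<Psi>. fst (iht M \<xi> k n s T f x \<Psi>)) \<gamma>\<^sub>0 \<and>
              (\<forall>\<Psi> \<in> space (gaussian_matrix k n).
                 snd (iht M \<xi> k n s T f x \<Psi>)
                   \<le> A * (ln (p / (p - \<gamma>\<^sub>0)) * real k * real n + real k * \<xi>)))))"
proof (intro conjI allI impI)
  show "\<exists>C c K. gaussian_rip_constants C c K"
    using gaussian_rip_constants_exist by blast
next
  fix C c K B \<eta> :: real
  assume rip: "gaussian_rip_constants C c K" and B: "0 < B" and \<eta>: "0 < \<eta>"
  have K: "0 < K" and C: "0 < C" using rip by (auto simp: gaussian_rip_constants_def)
  \<comment> \<open>Since \<open>\<eta>\<close> may be \<open>1\<close> or larger, it is capped to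
    keep the argument of the logarithm positive; the cap is still a lower bound for
    \<open>\<gamma>\<^sub>0\<close>.\<close>
  define L\<^sub>0 where "L\<^sub>0 = - ln (1 - min \<eta> (1 / 2))"
  have L\<^sub>0: "0 < L\<^sub>0" using \<eta> by (simp add: L\<^sub>0_def min_def)
  \<comment> \<open>The constant of \<open>iht_cost_le\<close> with \<open>D = 2 / K\<close>, the
    ratio supplied by \<open>enough_measurements_sparsity\<close>.\<close>
  define A where "A = B / L\<^sub>0 + (1 + 1 / L\<^sub>0) * (B * (5 + 2 / K)) + 1"
  have A: "0 < A"
    unfolding A_def using B K L\<^sub>0 by (intro add_nonneg_pos add_nonneg_nonneg mult_nonneg_nonneg) auto
  show "\<exists>A>0. \<forall>(n::nat) (s::nat) (k::nat) (f :: rvec \<Rightarrow> real) (x :: rvec) (\<xi>::real) (\<gamma>\<^sub>0::real) (M::cost_model).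
          1 \<le> s \<and> s \<le> n \<and> enough_measurements K n s k \<and>
          sparse_fun n s f \<and> differentiable_Rn n f \<and>
          0 \<le> \<xi> \<and> costs_bounded B M \<and>
          \<eta> \<le> \<gamma>\<^sub>0 \<and> \<gamma>\<^sub>0 < 1 \<and> \<gamma>\<^sub>0 < 1 - C * exp (- c * real k) \<longrightarrow>
          (let p = 1 - C * exp (- c * real k);
               T = iht_iterations (recovery_error p \<gamma>\<^sub>0)
           in is_refresh (gaussian_matrix k n) n f x (\<lambda>\<Psi>. fst (iht M \<xi> k n s T f x \<Psi>)) \<gamma>\<^sub>0 \<and>
              (\<forall>\<Psi> \<in> space (gaussian_matrix k n).
                 snd (iht M \<xi> k n s T f x \<Psi>)
                   \<le> A * (ln (p / (p - \<gamma>\<^sub>0)) * real k * real n + real k * \<xi>)))"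
    unfolding Let_def
  proof (intro exI[of _ A] conjI allI impI ballI A)
    fix n s k :: nat and f :: "rvec \<Rightarrow> real" and x :: rvec and \<xi> \<gamma>\<^sub>0 :: real and M :: cost_model
    assume a: "1 \<le> s \<and> s \<le> n \<and> enough_measurements K n s k \<and>
          sparse_fun n s f \<and> differentiable_Rn n f \<and> 0 \<le> \<xi> \<and> costs_bounded B M \<and>
          \<eta> \<le> \<gamma>\<^sub>0 \<and> \<gamma>\<^sub>0 < 1 \<and> \<gamma>\<^sub>0 < 1 - C * exp (- c * real k)"
    define p where "p = 1 - C * exp (- c * real k)"
    have k: "0 < k" using a K by (auto intro: enough_measurements_pos)
    have p: "\<gamma>\<^sub>0 < p" "p \<le> 1" using a C by (auto simp: p_def)
    show "is_refresh (gaussian_matrix k n) n f x (\<lambda>\<Psi>. fst (iht M \<xi> k n s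
        (iht_iterations (recovery_error (1 - C * exp (- c * real k)) \<gamma>\<^sub>0)) f x \<Psi>)) \<gamma>\<^sub>0"
      using a k \<eta> rip by (intro iht_is_refresh) (auto simp: gaussian_rip_constants_def)
    have \<eta>': "0 < min \<eta> (1 / 2)" "min \<eta> (1 / 2) < 1" "min \<eta> (1 / 2) \<le> \<gamma>\<^sub>0"
      using \<eta> a by auto
    note iterations = iht_iterations_le[OF \<eta>' p]
    have "real s \<le> 2 / K * real k"
      using enough_measurements_sparsity[OF K, of s n k] a by simp
    then show "snd (iht M \<xi> k n s (iht_iterations (recovery_error (1 - C * exp (- c * real k)) \<gamma>\<^sub>0)) f x \<Psi>)
        \<le> A * (ln ((1 - C * exp (- c * real k)) / (1 - C * exp (- c * real k) - \<gamma>\<^sub>0)) * real k * real n + real k * \<xi>)"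
      for \<Psi>
      unfolding A_def p_def[symmetric] using a k B L\<^sub>0 iterations
      by (intro iht_cost_le) (auto simp: L\<^sub>0_def)
  qed
qed

end
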